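(* Let $A$ be the Hermitian complex vector bundle of rank $2$ over $S^4 \cong \mathbb{H}P^1$ with $c_2(A) = 1 \in H^4(S^4;\mathbb{Z}) \cong \mathbb{Z}$ (the generalized Hopf bundle), and decompose $A \otimes A \cong \Lambda^2(A) \oplus \mathrm{Sym}^2(A)$ into its skew-symmetric (rank $1$) and symmetric (rank $3$) parts. Then: (i) $A \otimes A$ has no nowhere vanishing continuous section that is simple (of tensor rank $1$) at every point of $S^4$; (ii) $\Lambda^2(A)$ has a nowhere vanishing continuous section, which at each point $x$ has the form, up to a nonzero scalar, $|0\rangle|1\rangle - |1\rangle|0\rangle$ for an orthonormal basis $|0\rangle, |1\rangle$ of $A_x$; (iii) for every nowhere vanishing continuous section $\psi$ of $\mathrm{Sym}^2(A)$ there is a point $x \in S^4$ such that $\psi(x)$ is maximally entangled as a vector of $A_x \otimes A_x \cong \mathbb{C}^2 \otimes \mathbb{C}^2$.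
   Context: A nonzero vector in $A_x \otimes A_x$ is simple (tensor rank $1$) if it equals $v \otimes w$ for some $v, w \in A_x$. A nonzero vector of $\mathbb{C}^2 \otimes \mathbb{C}^2$ is maximally entangled if its two Schmidt coefficients are equal, i.e. if up to a nonzero scalar and the action of $\mathrm{U}(2) \times \mathrm{U}(2)$ it equals $|0\rangle|0\rangle + |1\rangle|1\rangle$. Equivalently, its $2 \times 2$ coefficient matrix in orthonormal bases is a nonzero scalar multiple of a unitary matrix. $\mathbb{H}P^1$ is the quaternionic projective line. *)

theory Defs
  imports "HOL-Analysis.Analysis" "HOL-Homology.Homology"
begin

section \<open>Hermitian vector bundles of rank 2\<close>

definition cinner2 :: "(complex^2) \<Rightarrow> (complex^2) \<Rightarrow> complex" where
  "cinner2 u v = (\<Sum>i\<in>UNIV. cnj (u $ i) * v $ i)"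

text \<open>The fields \<open>vzero\<close>, \<open>vplus\<close>, \<open>vscale\<close>, \<open>vinner\<close> hold the fibrewise zero vector, addition,
  scalar multiplication and Hermitian inner product (conjugate linear in the first argument).
  The values of the operations on vectors of different fibres are irrelevant.\<close>

record ('b, 'e) bundle_data =
  base :: "'b topology"
  total :: "'e topology"
  proj :: "'e \<Rightarrow> 'b"
  vzero :: "'b \<Rightarrow> 'e"
  vplus :: "'e \<Rightarrow> 'e \<Rightarrow> 'e"
  vscale :: "complex \<Rightarrow> 'e \<Rightarrow> 'e"
  vinner :: "'e \<Rightarrow> 'e \<Rightarrow> complex"

definition fibre :: "('b, 'e) bundle_data \<Rightarrow> 'b \<Rightarrow> 'e set" where
  "fibre A x = {e \<in> topspace (total A). proj A e = x}"

definition bundle_over :: "('b, 'e) bundle_data \<Rightarrow> 'b set \<Rightarrow> 'e topology" where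
  "bundle_over A U = subtopology (total A) {e. proj A e \<in> U}"

definition trivialization ::
    "('b, 'e) bundle_data \<Rightarrow> 'b set \<Rightarrow> ('b \<times> (complex^2) \<Rightarrow> 'e) \<Rightarrow> bool" where
  "trivialization A U \<phi> \<longleftrightarrow>
     U \<subseteq> topspace (base A) \<and>
     homeomorphic_map (prod_topology (subtopology (base A) U) euclidean) (bundle_over A U) \<phi> \<and>
     (\<forall>x\<in>U. (\<forall>u. proj A (\<phi> (x, u)) = x) \<and>
            \<phi> (x, 0) = vzero A x \<and>
            (\<forall>u v. \<phi> (x, u + v) = vplus A (\<phi> (x, u)) (\<phi> (x, v))) \<and>
            (\<forall>c u. \<phi> (x, c *s u) = vscale A c (\<phi> (x, u))) \<and>
            (\<forall>u v. vinner A (\<phi> (x, u)) (\<phi> (x, v)) = cinner2 u v))"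

text \<open>A Hermitian bundle is a bundle with structure group \<open>U(2)\<close>: it has local trivializations that
  are fibrewise linear isometries. A trivialization is fibrewise bijective onto the fibre, so the
  vector space and inner product axioms on the fibres follow from those on \<open>\<complex>\<^sup>2\<close>.\<close>

definition hermitian_bundle_rank2 :: "('b, 'e) bundle_data \<Rightarrow> bool" where
  "hermitian_bundle_rank2 A \<longleftrightarrow>
     continuous_map (total A) (base A) (proj A) \<and>
     (\<forall>x\<in>topspace (base A). \<exists>U \<phi>. openin (base A) U \<and> x \<in> U \<and> trivialization A U \<phi>)"

definition nonvanishing_section_on ::
    "('b, 'e) bundle_data \<Rightarrow> 'b set \<Rightarrow> ('b \<Rightarrow> 'e) \<Rightarrow> bool" where
  "nonvanishing_section_on A U s \<longleftrightarrow>
     continuous_map (subtopology (base A) U) (total A) s \<and>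
     (\<forall>x \<in> topspace (base A) \<inter> U. proj A (s x) = x \<and> s x \<noteq> vzero A x)"

text \<open>The fibre is two-dimensional, so an orthonormal pair is an orthonormal basis.\<close>

definition orthonormal_basis :: "('b, 'e) bundle_data \<Rightarrow> 'b \<Rightarrow> 'e \<Rightarrow> 'e \<Rightarrow> bool" where
  "orthonormal_basis A x e0 e1 \<longleftrightarrow>
     e0 \<in> fibre A x \<and> e1 \<in> fibre A x \<and>
     vinner A e0 e0 = 1 \<and> vinner A e1 e1 = 1 \<and> vinner A e0 e1 = 0"

section \<open>The second Chern number of a rank 2 bundle over the 4-sphere\<close>

text \<open>\<open>nsphere 4\<close> consists of the unit vectors supported on the coordinates \<open>0, \<dots>, 4\<close>, and its
  equator, where coordinate 4 vanishes, is the underlying set of \<open>nsphere 3\<close>.\<close>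

definition upper_hemisphere :: "(nat \<Rightarrow> real) set" where
  "upper_hemisphere = {x \<in> topspace (nsphere 4). x 4 \<ge> 0}"

definition lower_hemisphere :: "(nat \<Rightarrow> real) set" where
  "lower_hemisphere = {x \<in> topspace (nsphere 4). x 4 \<le> 0}"

definition sphere_coords :: "(complex^2) \<Rightarrow> nat \<Rightarrow> real" where
  "sphere_coords z = (\<lambda>i.
     (if i = 0 then Re (z $ 1) else if i = 1 then Im (z $ 1)
      else if i = 2 then Re (z $ 2) else if i = 3 then Im (z $ 2) else 0) / norm z)"

text \<open>For a bundle of complex rank 2, \<open>c\<^sub>2\<close> is the Euler class of the underlying oriented real
  bundle, that is, the obstruction to a nowhere vanishing section. Over \<open>S\<^sup>4\<close> it is computed by
  taking a nowhere vanishing section \<open>s\<close> over one hemisphere and a trivialization over the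
  other: the obstruction to extending \<open>s\<close> over the second hemisphere is the degree of the map
  \<open>S\<^sup>3 \<rightarrow> \<complex>\<^sup>2 - {0} \<rightarrow> S\<^sup>3\<close> which \<open>s\<close> induces on the equator. Here \<open>\<complex>\<^sup>2\<close> has its complex
  orientation, the upper hemisphere is oriented by the coordinates \<open>0, \<dots>, 3\<close> (which is the boundary
  orientation of \<open>S\<^sup>4\<close> in \<open>\<real>\<^sup>5\<close>), and \<open>H\<^sup>4(S\<^sup>4; \<int>)\<close> is identified with \<open>\<int>\<close> by that orientation.
  The degree does not depend on the choice of \<open>\<phi>\<close> and \<open>s\<close>.\<close>

definition has_second_chern_number :: "(nat \<Rightarrow> real, 'e) bundle_data \<Rightarrow> int \<Rightarrow> bool" where
  "has_second_chern_number A k \<longleftrightarrow>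
     (\<exists>\<phi> s g. trivialization A upper_hemisphere \<phi> \<and>
        nonvanishing_section_on A lower_hemisphere s \<and>
        (\<forall>x\<in>topspace (nsphere 3). s x = \<phi> (x, g x)) \<and>
        Brouwer_degree2 3 (\<lambda>x. sphere_coords (g x)) = k)"

section \<open>The bundle of tensors and its sections\<close>

text \<open>The tensor square of the finite-dimensional space \<open>V = fibre A x\<close> is the space of bilinear
  functions on the dual of \<open>V\<close>. Functionals and tensors are set to zero outside their domains,
  so that equality of tensors is equality of functions and the vector space operations on tensors
  are pointwise.\<close>

definition dual_fibre :: "('b, 'e) bundle_data \<Rightarrow> 'b \<Rightarrow> ('e \<Rightarrow> complex) set" where
  "dual_fibre A x = {\<alpha>.
     (\<forall>u. u \<notin> fibre A x \<longrightarrow> \<alpha> u = 0) \<and>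
     (\<forall>u\<in>fibre A x. \<forall>v\<in>fibre A x. \<alpha> (vplus A u v) = \<alpha> u + \<alpha> v) \<and>
     (\<forall>c. \<forall>u\<in>fibre A x. \<alpha> (vscale A c u) = c * \<alpha> u)}"

type_synonym 'e tensor2 = "('e \<Rightarrow> complex) \<Rightarrow> ('e \<Rightarrow> complex) \<Rightarrow> complex"

definition tensor_fibre :: "('b, 'e) bundle_data \<Rightarrow> 'b \<Rightarrow> 'e tensor2 set" where
  "tensor_fibre A x = {t.
     (\<forall>\<alpha> \<beta>. \<alpha> \<notin> dual_fibre A x \<or> \<beta> \<notin> dual_fibre A x \<longrightarrow> t \<alpha> \<beta> = 0) \<and>
     (\<forall>\<alpha>\<in>dual_fibre A x. \<forall>\<beta>\<in>dual_fibre A x. \<forall>\<gamma>\<in>dual_fibre A x.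
        t (\<lambda>u. \<alpha> u + \<beta> u) \<gamma> = t \<alpha> \<gamma> + t \<beta> \<gamma> \<and>
        t \<gamma> (\<lambda>u. \<alpha> u + \<beta> u) = t \<gamma> \<alpha> + t \<gamma> \<beta>) \<and>
     (\<forall>c. \<forall>\<alpha>\<in>dual_fibre A x. \<forall>\<beta>\<in>dual_fibre A x.
        t (\<lambda>u. c * \<alpha> u) \<beta> = c * t \<alpha> \<beta> \<and> t \<alpha> (\<lambda>u. c * \<beta> u) = c * t \<alpha> \<beta>)}"

definition tensor :: "('b, 'e) bundle_data \<Rightarrow> 'b \<Rightarrow> 'e \<Rightarrow> 'e \<Rightarrow> 'e tensor2" where
  "tensor A x v w = (\<lambda>\<alpha> \<beta>.
     if \<alpha> \<in> dual_fibre A x \<and> \<beta> \<in> dual_fibre A x then \<alpha> v * \<beta> w else 0)"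

definition sym_fibre :: "('b, 'e) bundle_data \<Rightarrow> 'b \<Rightarrow> 'e tensor2 set" where
  "sym_fibre A x = {t \<in> tensor_fibre A x. \<forall>\<alpha> \<beta>. t \<beta> \<alpha> = t \<alpha> \<beta>}"

definition skew_fibre :: "('b, 'e) bundle_data \<Rightarrow> 'b \<Rightarrow> 'e tensor2 set" where
  "skew_fibre A x = {t \<in> tensor_fibre A x. \<forall>\<alpha> \<beta>. t \<beta> \<alpha> = - t \<alpha> \<beta>}"

text \<open>Continuity of a section of the tensor square means that its components in the local frames
  \<open>\<phi> (y, axis i 1) \<otimes> \<phi> (y, axis j 1)\<close> induced by local trivializations of \<open>A\<close> are continuous.
  The transition functions are continuous, so one local trivialization around each point suffices.
  The symmetric and skew-symmetric parts carry the subspace topology.\<close>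

definition continuous_tensor_section ::
    "('b, 'e) bundle_data \<Rightarrow> ('b \<Rightarrow> 'e tensor2) \<Rightarrow> bool" where
  "continuous_tensor_section A \<psi> \<longleftrightarrow>
     (\<forall>x\<in>topspace (base A). \<psi> x \<in> tensor_fibre A x) \<and>
     (\<forall>x\<in>topspace (base A). \<exists>U \<phi> m.
        openin (base A) U \<and> x \<in> U \<and> trivialization A U \<phi> \<and>
        (\<forall>i j. continuous_map (subtopology (base A) U) euclidean (m i j)) \<and>
        (\<forall>y\<in>U. \<psi> y = (\<lambda>\<alpha> \<beta>. \<Sum>i\<in>(UNIV :: 2 set). \<Sum>j\<in>(UNIV :: 2 set).
            (m i j y :: complex) * tensor A y (\<phi> (y, axis i 1)) (\<phi> (y, axis j 1)) \<alpha> \<beta>)))"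

definition nowhere_vanishing ::
    "('b, 'e) bundle_data \<Rightarrow> ('b \<Rightarrow> 'e tensor2) \<Rightarrow> bool" where
  "nowhere_vanishing A \<psi> \<longleftrightarrow> (\<forall>x\<in>topspace (base A). \<psi> x \<noteq> (\<lambda>\<alpha> \<beta>. 0))"

definition simple_tensor :: "('b, 'e) bundle_data \<Rightarrow> 'b \<Rightarrow> 'e tensor2 \<Rightarrow> bool" where
  "simple_tensor A x t \<longleftrightarrow>
     t \<noteq> (\<lambda>\<alpha> \<beta>. 0) \<and> (\<exists>v\<in>fibre A x. \<exists>w\<in>fibre A x. t = tensor A x v w)"

text \<open>As \<open>U(2) \<times> U(2)\<close> acts simply transitively on pairs of orthonormal bases, the orbit of
  \<open>|0\<rangle>|0\<rangle> + |1\<rangle>|1\<rangle>\<close> consists of the tensors \<open>e0 \<otimes> f0 + e1 \<otimes> f1\<close>.\<close>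

definition maximally_entangled :: "('b, 'e) bundle_data \<Rightarrow> 'b \<Rightarrow> 'e tensor2 \<Rightarrow> bool" where
  "maximally_entangled A x t \<longleftrightarrow>
     (\<exists>e0 e1 f0 f1 c. orthonormal_basis A x e0 e1 \<and> orthonormal_basis A x f0 f1 \<and> c \<noteq> 0 \<and>
        t = (\<lambda>\<alpha> \<beta>. c * (tensor A x e0 f0 \<alpha> \<beta> + tensor A x e1 f1 \<alpha> \<beta>)))"

definition singlet :: "('b, 'e) bundle_data \<Rightarrow> 'b \<Rightarrow> 'e tensor2 \<Rightarrow> bool" where
  "singlet A x t \<longleftrightarrow>
     (\<exists>e0 e1 c. orthonormal_basis A x e0 e1 \<and> c \<noteq> 0 \<and>
        t = (\<lambda>\<alpha> \<beta>. c * (tensor A x e0 e1 \<alpha> \<beta> - tensor A x e1 e0 \<alpha> \<beta>)))"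

end

theory Submission
  imports Defs
begin

text \<open>Over each hemisphere \<open>A\<close> has an isometric frame; the two frames differ on the equator by a map
  \<open>G\<close> from \<open>S\<^sup>3\<close> to \<open>U(2)\<close>, and \<open>c\<^sub>2(A) \<noteq> 0\<close> says that \<open>z \<mapsto> G z *v u\<close> is not nullhomotopic in
  \<open>\<complex>\<^sup>2 - {0}\<close> for \<open>u \<noteq> 0\<close>. As \<open>S\<^sup>3\<close> is simply connected, \<open>det G\<close> has a logarithm, so the frames can
  be chosen with \<open>det G = 1\<close>; then the skew tensors \<open>e1 \<otimes> e2 - e2 \<otimes> e1\<close> of the two frames agree on the
  equator, which gives (ii).

  Let \<open>\<psi>\<close> be a nonvanishing section of \<open>A \<otimes> A\<close> that is nowhere maximally entangled, with coefficient
  matrix \<open>M\<close>. Then \<open>M M\<^sup>*\<close> is nowhere scalar, and its larger eigenvalue defines a line subbundle of \<open>A\<close>.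
  Over each hemisphere the line is spanned by a nonvanishing section, and on the equator the ratio
  of the two sections has a logarithm, so \<open>G z *v u\<close> would be nullhomotopic. Hence every nonvanishing
  section of \<open>A \<otimes> A\<close> is maximally entangled somewhere, which gives (iii), and also (i) because simple
  tensors are not maximally entangled.\<close>

section \<open>Two by two complex matrices\<close>

text \<open>The obstacle is that \<open>has_second_chern_number\<close> supplies a frame over the
  upper hemisphere but only one section over the lower one, whereas the eigenline and the
  determinant correction need frames on both sides. So triviality of the bundle over a ball has to
  be proved; this is done on a cube cut into small boxes. Frames are kept isometric because a
  unitary transition \<open>G\<close> turns the coefficient matrix \<open>M'\<close> into
  \<open>G M' G^T\<close>; then \<open>M\<close> times its adjoint is conjugated by
  \<open>G\<close>, and its eigenspaces are subspaces of the fibre that do not depend on the frame.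
  For a nonzero tensor this product is scalar only if \<open>M\<close> is a multiple of a unitary
  matrix. Away from such tensors the two eigenvalues differ, so the larger one has a line as
  eigenspace, varying continuously. Finally, the section that computes the degree may be exchanged
  for a spanning vector of that line: any two nonvanishing vector functions on a ball are homotopic
  through such functions, and \<open>G\<close> preserves this on the sphere.\<close>

definition adjoint_mat :: "complex^'n^'m \<Rightarrow> complex^'m^'n" where
  "adjoint_mat A = (\<chi> i j. cnj (A $ j $ i))"

lemma mat2_eq_iff:
  fixes A B :: "'a^2^2"
  shows "A = B \<longleftrightarrow> A$1$1 = B$1$1 \<and> A$1$2 = B$1$2 \<and> A$2$1 = B$2$1 \<and> A$2$2 = B$2$2"
  by (auto simp: vec_eq_iff forall_2)

lemma vec2_eq_iff:
  fixes u v :: "'a^2"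
  shows "u = v \<longleftrightarrow> u$1 = v$1 \<and> u$2 = v$2"
  by (auto simp: vec_eq_iff forall_2)

lemma matrix_mul_2:
  fixes A B :: "'a::semiring_1^2^2"
  shows "(A ** B)$i$j = A$i$1 * B$1$j + A$i$2 * B$2$j"
  by (simp add: matrix_matrix_mult_def sum_2)

lemma matrix_vec_2:
  fixes A :: "'a::semiring_1^2^2"
  shows "(A *v u)$i = A$i$1 * u$1 + A$i$2 * u$2"
  by (simp add: matrix_vector_mult_def sum_2)

lemma mat_nth: "mat c $ i $ j = (if i = j then c else 0)"
  by (simp add: mat_def)

lemma adjoint_mat_nth [simp]: "adjoint_mat A $ i $ j = cnj (A $ j $ i)"
  by (simp add: adjoint_mat_def)

lemma adjoint_mat_mult:
  "adjoint_mat (A ** B) = adjoint_mat B ** adjoint_mat A"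
  by (simp add: vec_eq_iff matrix_matrix_mult_def mult.commute)

lemma cinner2_expand: "cinner2 u v = cnj (u$1) * v$1 + cnj (u$2) * v$2"
  by (simp add: cinner2_def sum_2)

lemma cinner2_self: "cinner2 u u = complex_of_real ((norm u)\<^sup>2)"
  by (simp add: cinner2_expand norm_vec_def L2_set_def sum_2 mult.commute [of "cnj _"]
      complex_norm_square [symmetric] del: of_real_add)
    (simp add: complex_norm_square)

lemma cinner2_self_eq_0_iff: "cinner2 u u = 0 \<longleftrightarrow> u = 0"
  by (simp add: cinner2_self)

lemma cinner2_matrix_left: "cinner2 (A *v u) v = cinner2 u (adjoint_mat A *v v)"
  by (simp add: cinner2_expand matrix_vec_2 algebra_simps)

lemma isometry_matrix_iff:
  fixes K :: "complex^2^2"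
  shows "(\<forall>u v. cinner2 (K *v u) (K *v v) = cinner2 u v) \<longleftrightarrow> adjoint_mat K ** K = mat 1"
proof
  assume *: "\<forall>u v. cinner2 (K *v u) (K *v v) = cinner2 u v"
  have "(adjoint_mat K ** K) $ i $ j = cinner2 (K *v axis i 1) (K *v axis j 1)" for i j
    by (simp add: matrix_vector_mul_assoc cinner2_matrix_left)
      (simp add: cinner2_def axis_def if_distrib [of cnj] if_distrib [of "\<lambda>x. x * _"]
        matrix_vector_mult_def if_distrib [of "\<lambda>x. _ * x"] cong: if_cong)
  then show "adjoint_mat K ** K = mat 1"
    using * by (simp add: mat2_eq_iff mat_nth cinner2_expand axis_def)
next
  assume "adjoint_mat K ** K = mat 1"
  then show "\<forall>u v. cinner2 (K *v u) (K *v v) = cinner2 u v"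
    by (simp add: cinner2_matrix_left matrix_vector_mul_assoc)
qed

lemma isometry_matrix_vec_nonzero:
  fixes K :: "complex^2^2"
  assumes "adjoint_mat K ** K = mat 1" "u \<noteq> 0"
  shows "K *v u \<noteq> 0"
  by (metis assms matrix_vector_mul_assoc matrix_vector_mul_lid matrix_vector_mult_0_right)

lemma mat_commute:
  fixes A :: "'a::comm_semiring_1^2^2"
  shows "A ** mat c = mat c ** A"
  by (simp add: mat2_eq_iff matrix_mul_2 mat_nth mult.commute)

text \<open>After division by \<open>c\<close> the adjoint is a right inverse of a square matrix,
  hence a left inverse. The hypothesis makes the rows of \<open>M\<close> orthogonal;
  \<open>maximally_entangledI\<close> needs the columns.\<close>

lemma scalar_mul_adjoint_swap:
  fixes M :: "complex^2^2"
  assumes "M ** adjoint_mat M = mat c" "c \<noteq> 0"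
  shows "adjoint_mat M ** M = mat c"
proof -
  have "M ** (mat (inverse c) ** adjoint_mat M) = mat 1"
    using assms by (simp add: matrix_mul_assoc mat_commute [of M])
      (simp flip: matrix_mul_assoc, simp add: mat2_eq_iff matrix_mul_2 mat_nth)
  then have "mat (inverse c) ** adjoint_mat M ** M = mat 1"
    by (simp add: matrix_left_right_inverse)
  then have "mat c ** (mat (inverse c) ** adjoint_mat M ** M) = mat c"
    by simp
  moreover have "mat c ** mat (inverse c) = (mat 1 :: complex^2^2)"
    using \<open>c \<noteq> 0\<close> by (simp add: mat2_eq_iff matrix_mul_2 mat_nth)
  ultimately show ?thesis by (simp add: matrix_mul_assoc)
qed

text \<open>For a Hermitian matrix \<open>N\<close>, the number \<open>eigen_gap N\<close> is half the difference of the two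
  eigenvalues, and \<open>top_projector N\<close> is the orthogonal projection to the larger eigenspace.\<close>

definition eigen_gap :: "complex^2^2 \<Rightarrow> real" where
  "eigen_gap N = sqrt (cmod ((trace N)\<^sup>2 / 4 - det N))"

definition top_projector :: "complex^2^2 \<Rightarrow> complex^2^2" where
  "top_projector N =
     mat (1/2) + mat (1 / (2 * of_real (eigen_gap N))) ** (N - mat (trace N / 2))"

text \<open>As a sum of squares the discriminant is real and nonnegative. Hence the
  \<open>cmod\<close> under the root in \<open>eigen_gap\<close> does not alter it, and a zero gap
  forces both squares to vanish, that is, \<open>N\<close> to be scalar.\<close>

lemma hermitian_discriminant:
  fixes N :: "complex^2^2"
  assumes "adjoint_mat N = N"
  shows "(trace N)\<^sup>2 / 4 - det N
     = complex_of_real ((Re (N$1$1 - N$2$2) / 2)\<^sup>2 + (cmod (N$1$2))\<^sup>2)"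
proof -
  have "cnj (N$1$1) = N$1$1" "cnj (N$2$2) = N$2$2" and N21: "N$2$1 = cnj (N$1$2)"
    using assms by (simp_all add: mat2_eq_iff)
  then have "N$1$1 = complex_of_real (Re (N$1$1))" "N$2$2 = complex_of_real (Re (N$2$2))"
    by (metis complex_cnj_complex_of_real Reals_cnj_iff of_real_Re)+
  then obtain a d where N: "N$1$1 = complex_of_real a" "N$2$2 = complex_of_real d"
    by blast
  have "(trace N)\<^sup>2 / 4 - det N = ((N$1$1 - N$2$2) / 2)\<^sup>2 + N$1$2 * N$2$1"
    by (simp add: trace_def det_2 sum_2 power2_eq_square field_simps)
  also have "\<dots> = complex_of_real (((a - d) / 2)\<^sup>2 + (cmod (N$1$2))\<^sup>2)"
    unfolding N21 complex_norm_square [symmetric] N by simp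
  finally show ?thesis by (simp add: N)
qed

lemma eigen_gap_sq:
  fixes N :: "complex^2^2"
  assumes "adjoint_mat N = N"
  shows "(complex_of_real (eigen_gap N))\<^sup>2 = (trace N)\<^sup>2 / 4 - det N"
proof -
  have "(eigen_gap N)\<^sup>2 = cmod ((trace N)\<^sup>2 / 4 - det N)"
    by (simp add: eigen_gap_def)
  also have "\<dots> = (Re (N$1$1 - N$2$2) / 2)\<^sup>2 + (cmod (N$1$2))\<^sup>2"
    unfolding hermitian_discriminant [OF assms] norm_of_real by simp
  finally show ?thesis
    unfolding hermitian_discriminant [OF assms] by (metis of_real_power)
qed

lemma eigen_gap_nonzero:
  fixes N :: "complex^2^2"
  assumes "adjoint_mat N = N" "\<And>c. N \<noteq> mat c"
  shows "eigen_gap N \<noteq> 0"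
proof
  assume "eigen_gap N = 0"
  then have "(Re (N$1$1 - N$2$2) / 2)\<^sup>2 + (cmod (N$1$2))\<^sup>2 = 0"
    unfolding eigen_gap_def hermitian_discriminant [OF assms(1)] norm_of_real by simp
  then have "Re (N$1$1) = Re (N$2$2)" "N$1$2 = 0"
    by (simp_all add: add_nonneg_eq_0_iff)
  moreover have "cnj (N$1$1) = N$1$1" "cnj (N$2$2) = N$2$2" "N$2$1 = cnj (N$1$2)"
    using assms(1) by (simp_all add: mat2_eq_iff)
  ultimately have "N = mat (N$1$1)"
    by (auto simp: mat2_eq_iff mat_nth complex_eq_iff)
  then show False using assms(2) by blast
qed

text \<open>Let \<open>B\<close> be the traceless part of \<open>N\<close> and \<open>r\<close> the
  gap. By Cayley-Hamilton the square of \<open>B\<close> is \<open>r^2\<close> times the identity,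
  so \<open>1/2 + B/(2r)\<close> is idempotent; its trace is that of \<open>1/2\<close>. In the
  proof \<open>h\<close>, \<open>q\<close>, \<open>s\<close> are entries of \<open>B/(2r)\<close>,
  and \<open>h * h + q * s = 1/4\<close> is this identity.\<close>

lemma
  fixes N :: "complex^2^2"
  assumes "adjoint_mat N = N" "\<And>c. N \<noteq> mat c"
  shows top_projector_idem: "top_projector N ** top_projector N = top_projector N"
    and trace_top_projector: "trace (top_projector N) = 1"
proof -
  define r where "r = complex_of_real (eigen_gap N)"
  have r: "r \<noteq> 0" using eigen_gap_nonzero assms by (simp add: r_def)
  have "4 * r\<^sup>2 = (trace N)\<^sup>2 - 4 * det N"
    using eigen_gap_sq [OF assms(1)] by (simp add: r_def)
  then have r2: "4 * (r * r) = (N$1$1 - N$2$2) * (N$1$1 - N$2$2) + 4 * (N$1$2 * N$2$1)"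
    by (simp add: trace_def det_2 sum_2 power2_eq_square algebra_simps)
  define h q s where "h = (N$1$1 - N$2$2) / (4 * r)" and "q = N$1$2 / (2 * r)"
    and "s = N$2$1 / (2 * r)"
  have P: "top_projector N $1$1 = 1/2 + h" "top_projector N $1$2 = q"
    "top_projector N $2$1 = s" "top_projector N $2$2 = 1/2 - h"
    using r by (simp_all add: top_projector_def matrix_mul_2 mat_nth trace_def sum_2 h_def q_def s_def
        field_simps flip: r_def)
  have "(16 * (r * r)) * (h * h + q * s) = (16 * (r * r)) * (1/4)"
  proof -
    have e: "h * (4 * r) = N$1$1 - N$2$2" "q * (2 * r) = N$1$2" "s * (2 * r) = N$2$1"
      using r by (simp_all add: h_def q_def s_def)
    have "16 * (r * r) * (h * h + q * s)
        = h * (4 * r) * (h * (4 * r)) + 4 * (q * (2 * r) * (s * (2 * r)))"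
      by (simp add: algebra_simps)
    then show ?thesis using r2 by (simp add: e)
  qed
  then have hqs: "h * h + q * s = 1/4"
    using r by (simp only: mult_cancel_left) simp
  then have qs: "q * s = 1/4 - h * h" "s * q = 1/4 - h * h"
    by (metis add_diff_cancel_left' mult.commute)+
  show "top_projector N ** top_projector N = top_projector N"
    unfolding mat2_eq_iff matrix_mul_2 P qs by (simp add: algebra_simps)
  show "trace (top_projector N) = 1"
    by (simp add: trace_def sum_2 P)
qed

text \<open>The coefficients in the formula depend only on trace and determinant, which conjugation
  preserves, and scalar matrices are fixed by it. This is why the eigenlines over the two
  hemispheres correspond under the transition matrix.\<close>

lemma top_projector_conj:
  assumes "adjoint_mat G ** G = mat 1"
  shows "top_projector (G ** N ** adjoint_mat G) = G ** top_projector N ** adjoint_mat G"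
proof -
  have G': "G ** adjoint_mat G = mat 1"
    using assms by (simp add: matrix_left_right_inverse)
  have tr: "trace (G ** N ** adjoint_mat G) = trace N"
    by (metis assms matrix_mul_assoc matrix_mul_lid trace_mul_sym)
  have "det (G ** N ** adjoint_mat G) = det N * det (adjoint_mat G ** G)"
    by (simp add: det_mul)
  then have gap: "eigen_gap (G ** N ** adjoint_mat G) = eigen_gap N"
    by (simp add: eigen_gap_def tr assms)
  have c: "G ** mat c ** adjoint_mat G = mat c" for c
    by (metis G' mat_commute matrix_mul_assoc matrix_mul_rid)
  have s: "G ** (mat c ** M) ** adjoint_mat G = mat c ** (G ** M ** adjoint_mat G)" for c M
    by (metis mat_commute matrix_mul_assoc)
  have d: "G ** (A - B) ** adjoint_mat G = G ** A ** adjoint_mat G - G ** B ** adjoint_mat G" for A B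
    by (simp add: mat2_eq_iff matrix_mul_2 algebra_simps)
  have a: "(A + B) ** C = A ** C + B ** C" for A B C :: "complex^2^2"
    by (simp add: mat2_eq_iff matrix_mul_2 algebra_simps)
  show ?thesis
    unfolding top_projector_def gap tr
    by (simp add: matrix_add_ldistrib a c s d)
qed

text \<open>Two independent fixed vectors would make \<open>P\<close> the identity, of trace 2. The
  coefficient is written with inner products so that it depends continuously on \<open>u\<close> and
  \<open>w\<close>.\<close>

lemma fixed_line:
  fixes P :: "complex^2^2"
  assumes "trace P = 1" "P *v u = u" "P *v w = w" "u \<noteq> 0"
  shows "w = (cinner2 u w / cinner2 u u) *s u"
proof -
  have P22: "P$2$2 = 1 - P$1$1"
    using assms(1) by (simp add: trace_def sum_2 algebra_simps)
  have u: "P$1$1 * u$1 + P$1$2 * u$2 = u$1" "P$2$1 * u$1 = P$1$1 * u$2"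
    using assms(2) by (simp_all add: vec2_eq_iff matrix_vec_2 P22 algebra_simps)
  have w: "P$1$1 * w$1 + P$1$2 * w$2 = w$1" "P$2$1 * w$1 = P$1$1 * w$2"
    using assms(3) by (simp_all add: vec2_eq_iff matrix_vec_2 P22 algebra_simps)
  have "u$1 * w$2 = u$2 * w$1"
  proof (cases "P$1$1 = 0")
    case True
    then have "u$1 = P$1$2 * u$2" "w$1 = P$1$2 * w$2"
      using u w by auto
    then show ?thesis by simp
  next
    case False
    have "P$1$1 * (u$1 * w$2) = u$1 * (P$1$1 * w$2)"
      by (rule mult.left_commute)
    also have "\<dots> = (P$2$1 * u$1) * w$1"
      unfolding w(2) [symmetric] by (simp add: algebra_simps)
    also have "\<dots> = P$1$1 * (u$2 * w$1)"
      unfolding u(2) by (rule mult.assoc)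
    finally have "P$1$1 * (u$1 * w$2) = P$1$1 * (u$2 * w$1)" .
    then show ?thesis using False by simp
  qed
  then have uw: "u$2 * w$1 = u$1 * w$2" ..
  have nz: "cnj (u$1) * u$1 + cnj (u$2) * u$2 \<noteq> 0"
    using cinner2_self_eq_0_iff [of u] assms(4) by (simp add: cinner2_expand)
  have "w$1 * (cnj (u$1) * u$1 + cnj (u$2) * u$2) = (cnj (u$1) * w$1 + cnj (u$2) * w$2) * u$1"
       "w$2 * (cnj (u$1) * u$1 + cnj (u$2) * u$2) = (cnj (u$1) * w$1 + cnj (u$2) * w$2) * u$2"
    using uw by (simp_all add: algebra_simps)
  then show ?thesis
    using nz by (simp add: vec2_eq_iff cinner2_expand eq_divide_eq)
qed

section \<open>Eigenvector fields and null homotopies\<close>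

lemma bounded_bilinear_matrix_vector_mult:
  "bounded_bilinear (\<lambda>(A::complex^'n^'m) (u::complex^'n). A *v u)"
proof -
  have "bilinear (\<lambda>(A::complex^'n^'m) (u::complex^'n). A *v u)"
    unfolding bilinear_def
    by (auto intro!: linearI simp: vec_eq_iff matrix_vector_mult_def algebra_simps sum.distrib
        scaleR_sum_right)
  then show ?thesis by (simp add: bilinear_conv_bounded_bilinear)
qed

lemmas continuous_on_matrix_vector_mult [continuous_intros] =
  bounded_bilinear.continuous_on [OF bounded_bilinear_matrix_vector_mult]

lemma continuous_on_matrix_iff:
  fixes f :: "'a::topological_space \<Rightarrow> ('b::topological_space)^'n^'m"
  shows "continuous_on S f \<longleftrightarrow> (\<forall>i j. continuous_on S (\<lambda>x. f x $ i $ j))"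
proof
  assume "\<forall>i j. continuous_on S (\<lambda>x. f x $ i $ j)"
  then have "continuous_on S (\<lambda>x. \<chi> i j. f x $ i $ j)"
    by (intro continuous_on_vec_lambda) auto
  then show "continuous_on S f" by simp
qed (auto intro: continuous_intros)

lemma continuous_on_matrix_mult_2 [continuous_intros]:
  fixes f g :: "'a::topological_space \<Rightarrow> complex^2^2"
  assumes "continuous_on S f" "continuous_on S g"
  shows "continuous_on S (\<lambda>x. f x ** g x)"
  unfolding continuous_on_matrix_iff matrix_mul_2
  by (intro allI continuous_intros assms)

lemma continuous_on_adjoint_mat [continuous_intros]:
  fixes f :: "'a::topological_space \<Rightarrow> complex^'n^'m"
  assumes "continuous_on S f"
  shows "continuous_on S (\<lambda>x. adjoint_mat (f x))"
  unfolding continuous_on_matrix_iff adjoint_mat_nth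
  by (intro allI continuous_intros assms)

lemma continuous_on_mat [continuous_intros]:
  assumes "continuous_on S c"
  shows "continuous_on S (\<lambda>x. mat (c x) :: 'a::{zero,topological_space}^'n^'n)"
  unfolding continuous_on_matrix_iff mat_nth
proof (intro allI)
  fix i j
  show "continuous_on S (\<lambda>x. if i = j then c x else 0)"
    using assms by (cases "i = j") auto
qed

lemma continuous_on_top_projector:
  fixes N :: "'a::topological_space \<Rightarrow> complex^2^2"
  assumes "continuous_on S N" "\<And>x. x \<in> S \<Longrightarrow> eigen_gap (N x) \<noteq> 0"
  shows "continuous_on S (\<lambda>x. top_projector (N x))"
proof -
  have "continuous_on S (\<lambda>x. eigen_gap (N x))"
    unfolding eigen_gap_def trace_def det_2 sum_2 by (intro continuous_intros assms) auto
  moreover have "continuous_on S (\<lambda>x. trace (N x))"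
    unfolding trace_def sum_2 by (intro continuous_intros assms)
  ultimately show ?thesis
    unfolding top_projector_def
    by (intro continuous_intros assms) (auto simp: assms)
qed

text \<open>This trivializes the eigenline over a ball. The same starting vector
  \<open>P 0 *v w0\<close> serves every radius, so the transported vector depends continuously on
  \<open>z\<close>, also at the centre.\<close>

lemma idempotent_field_fixed_section:
  fixes P :: "'a::euclidean_space \<Rightarrow> complex^'n^'n"
  assumes P: "continuous_on (cball 0 1) P"
    and idem: "\<And>z. z \<in> cball 0 1 \<Longrightarrow> P z ** P z = P z"
    and "P 0 \<noteq> 0"
  obtains v where "continuous_on (cball 0 1) v"
    "\<And>z. z \<in> cball 0 1 \<Longrightarrow> P z *v v z = v z" "\<And>z. z \<in> cball 0 1 \<Longrightarrow> v z \<noteq> 0"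
proof -
  \<comment> \<open>The norm on matrices is not the operator norm, so \<open>K\<close> mediates: a
    change of \<open>P\<close> by less than \<open>1 / K\<close> moves a nonzero vector by less than
    its length, hence not to 0.\<close>
  obtain K where K: "K > 0" "\<And>(A::complex^'n^'n) u. norm (A *v u) \<le> norm A * norm u * K"
    using bounded_bilinear.pos_bounded [OF bounded_bilinear_matrix_vector_mult] by blast
  obtain w0 where w0: "P 0 *v w0 \<noteq> 0"
    using \<open>P 0 \<noteq> 0\<close> by (metis matrix_eq matrix_vector_mult_0)
  have "uniformly_continuous_on (cball 0 1) P"
    using P by (simp add: compact_uniformly_continuous)
  then obtain d where d: "d > 0"
    "\<And>x y. x \<in> cball 0 1 \<Longrightarrow> y \<in> cball 0 1 \<Longrightarrow> dist x y < d \<Longrightarrow> dist (P x) (P y) < 1 / K"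
    unfolding uniformly_continuous_on_def by (metis K(1) zero_less_divide_1_iff)
  obtain n :: nat where n: "1 / d < real n"
    using reals_Archimedean2 by blast
  have "n > 0" using n d(1) by (cases "n = 0") (auto simp: field_simps)
  define pt where "pt k z = (real k / real n) *\<^sub>R z" for k :: nat and z :: 'a
  \<comment> \<open>Discrete parallel transport along the radii: successive points are so close that each
    projection is injective on the image of the previous one.\<close>
  define v where "v k z = rec_nat (P 0 *v w0) (\<lambda>j w. P (pt (Suc j) z) *v w) k" for k z
  have v: "v 0 z = P 0 *v w0" "v (Suc k) z = P (pt (Suc k) z) *v v k z" for k z
    by (simp_all add: v_def)
  have pt: "pt k z \<in> cball 0 1" if "k \<le> n" "z \<in> cball 0 1" for k z
  proof -
    have "real k / real n * norm z \<le> 1 * 1"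
      using that \<open>n > 0\<close> by (intro mult_mono) auto
    then show ?thesis by (simp add: pt_def)
  qed
  have "continuous_on (cball 0 1) (v k)" if "k \<le> n" for k
    using that
  proof (induction k)
    case (Suc k)
    then have "continuous_on (cball 0 1) (\<lambda>z. P (pt (Suc k) z))"
      using pt [of "Suc k"] unfolding pt_def
      by (intro continuous_on_compose2 [OF P]) (auto intro!: continuous_intros)
    with Suc show ?case
      unfolding v(2) [abs_def] by (auto intro!: continuous_intros)
  qed (simp add: v)
  moreover have "P (pt k z) *v v k z = v k z \<and> v k z \<noteq> 0" if "k \<le> n" "z \<in> cball 0 1" for k z
    using that
  proof (induction k)
    case 0
    then show ?case
      using idem [of 0] w0 by (simp add: v pt_def matrix_vector_mul_assoc)
  next
    case (Suc k)
    let ?x = "pt k z" and ?y = "pt (Suc k) z"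
    have IH: "P ?x *v v k z = v k z" "v k z \<noteq> 0"
      using Suc by auto
    have xy: "?x \<in> cball 0 1" "?y \<in> cball 0 1"
      using Suc.prems pt by auto
    have "?y - ?x = (1 / real n) *\<^sub>R z"
      by (simp add: pt_def add_divide_distrib algebra_simps)
    then have "dist ?y ?x = norm z / real n"
      by (simp add: dist_norm)
    also have "\<dots> \<le> 1 / real n"
      using Suc.prems by (simp add: divide_right_mono)
    also have "\<dots> < d"
      using n d(1) \<open>n > 0\<close> by (simp add: field_simps)
    finally have less: "norm (P ?y - P ?x) < 1 / K"
      using d(2) xy by (simp add: dist_norm)
    have "norm (P ?y *v v k z - v k z) = norm ((P ?y - P ?x) *v v k z)"
      by (simp add: matrix_vector_mult_diff_rdistrib IH)
    also have "\<dots> \<le> norm (P ?y - P ?x) * norm (v k z) * K"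
      by (rule K)
    also have "\<dots> < norm (v k z)"
      using less K(1) IH(2) by (simp add: field_simps)
    finally have "P ?y *v v k z \<noteq> 0" by auto
    then show ?case
      using idem [OF xy(2)] by (simp add: v matrix_vector_mul_assoc)
  qed
  moreover have "pt n z = z" for z
    using \<open>n > 0\<close> by (simp add: pt_def)
  ultimately show ?thesis
    using that [of "v n"] by (metis order_refl)
qed

section \<open>Homotopies of maps from the sphere to nonzero vectors\<close>

lemma homotopic_canonI:
  assumes "continuous_on ({0..1} \<times> S) (\<lambda>(t, x). H t x)"
    and "\<And>t x. t \<in> {0..1::real} \<Longrightarrow> x \<in> S \<Longrightarrow> H t x \<in> T"
    and "\<And>x. x \<in> S \<Longrightarrow> H 0 x = f x" "\<And>x. x \<in> S \<Longrightarrow> H 1 x = g x"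
  shows "homotopic_with_canon (\<lambda>_. True) S T f g"
proof -
  have "homotopic_with_canon (\<lambda>_. True) S T (H 0) (H 1)"
    unfolding homotopic_with_def
    using assms(1,2) by (intro exI [of _ "\<lambda>(t, x). H t x"]) (auto simp: continuous_map_in_subtopology)
  then show ?thesis
    by (rule homotopic_with_eq) (simp_all add: assms)
qed

text \<open>Shrinking the radius deforms \<open>s\<close> to the constant \<open>s 0\<close> and
  \<open>v\<close> to \<open>v 0\<close>, and a path in the connected set of nonzero vectors joins
  these two. Applying the injective \<open>G z\<close> keeps all stages nonzero, although
  \<open>G\<close> itself is given on the sphere only.\<close>

lemma isometry_field_transport_homotopic:
  fixes G :: "'a::real_normed_vector \<Rightarrow> complex^2^2"
  assumes G: "continuous_on (sphere 0 1) G"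
    and iso: "\<And>z. z \<in> sphere 0 1 \<Longrightarrow> adjoint_mat (G z) ** G z = mat 1"
    and s: "continuous_on (cball 0 1) s" "\<And>z. z \<in> cball 0 1 \<Longrightarrow> s z \<noteq> 0"
    and v: "continuous_on (cball 0 1) v" "\<And>z. z \<in> cball 0 1 \<Longrightarrow> v z \<noteq> 0"
  shows "homotopic_with_canon (\<lambda>_. True) (sphere 0 1) (-{0}) (\<lambda>z. G z *v s z) (\<lambda>z. G z *v v z)"
proof -
  have shrink: "homotopic_with_canon (\<lambda>_. True) (sphere 0 1) (-{0}) (\<lambda>z. G z *v u 0) (\<lambda>z. G z *v u z)"
    if u: "continuous_on (cball 0 1) u" "\<And>z. z \<in> cball 0 1 \<Longrightarrow> u z \<noteq> 0" for u
  proof (rule homotopic_canonI [where H = "\<lambda>t z. G z *v u (t *\<^sub>R z)"])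
    have "continuous_on ({0..1} \<times> sphere 0 1) (\<lambda>x. u (fst x *\<^sub>R snd x))"
      by (intro continuous_on_compose2 [OF u(1)] continuous_intros) auto
    moreover have "continuous_on ({0..1::real} \<times> sphere 0 1) (\<lambda>x. G (snd x))"
      by (intro continuous_on_compose2 [OF G] continuous_intros) auto
    ultimately show "continuous_on ({0..1} \<times> sphere 0 1) (\<lambda>(t, z). G z *v u (t *\<^sub>R z))"
      unfolding case_prod_beta by (intro continuous_intros)
    show "G z *v u (t *\<^sub>R z) \<in> - {0}" if "t \<in> {0..1}" "z \<in> sphere 0 1" for t z
      using that u(2) [of "t *\<^sub>R z"] isometry_matrix_vec_nonzero [OF iso] by auto
  qed auto
  have "path_connected (- {0 :: complex^2})"
    by (rule path_connected_punctured_universe) simp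
  moreover have "s 0 \<in> -{0}" "v 0 \<in> -{0}"
    using s(2) [of 0] v(2) [of 0] by auto
  ultimately obtain g where g: "path g" "path_image g \<subseteq> -{0}" "pathstart g = s 0" "pathfinish g = v 0"
    unfolding path_connected_def by blast
  have "homotopic_with_canon (\<lambda>_. True) (sphere 0 1) (-{0}) (\<lambda>z. G z *v s 0) (\<lambda>z. G z *v v 0)"
  proof (rule homotopic_canonI [where H = "\<lambda>t z. G z *v g t"])
    have "continuous_on ({0..1} \<times> sphere (0::'a) 1) (\<lambda>x. g (fst x))"
      using g(1) unfolding path_def
      by (rule continuous_on_compose2) (auto intro!: continuous_intros)
    moreover have "continuous_on ({0..1::real} \<times> sphere 0 1) (\<lambda>x. G (snd x))"
      by (intro continuous_on_compose2 [OF G] continuous_intros) auto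
    ultimately show "continuous_on ({0..1} \<times> sphere 0 1) (\<lambda>(t, z). G z *v g t)"
      unfolding case_prod_beta by (intro continuous_intros)
    show "G z *v g t \<in> - {0}" if "t \<in> {0..1}" "z \<in> sphere 0 1" for t z
    proof -
      have "g t \<noteq> 0" using that(1) g(2) by (auto simp: path_image_def)
      then show ?thesis using isometry_matrix_vec_nonzero [OF iso [OF that(2)]] by blast
    qed
  qed (use g in \<open>auto simp: pathstart_def pathfinish_def\<close>)
  with shrink [OF s] shrink [OF v] show ?thesis
    by (meson homotopic_with_sym homotopic_with_trans)
qed

lemma continuous_logarithm_on_sphere:
  fixes f :: "'a::euclidean_space \<Rightarrow> complex"
  assumes "3 \<le> DIM('a)" "continuous_on (sphere 0 1) f" "\<And>z. z \<in> sphere 0 1 \<Longrightarrow> f z \<noteq> 0"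
  obtains l where "continuous_on (sphere 0 1) l" "\<And>z. z \<in> sphere 0 1 \<Longrightarrow> f z = exp (l z)"
  using continuous_logarithm_on_simply_connected [of "sphere 0 1" f] assms
    simply_connected_sphere [of 0 1] locally_path_connected_sphere by metis

text \<open>The larger eigenvalue of \<open>M M\<^sup>*\<close> gives a line over each of the two balls, and \<open>G\<close> carries one to the
  other on the bounding sphere: there the two lines are spanned by vectors whose ratio has a logarithm,
  and the vectors themselves extend over the balls.\<close>

lemma clutching_nullhomotopic:
  fixes G :: "complex^2 \<Rightarrow> complex^2^2"
  assumes G: "continuous_on (sphere 0 1) G"
    and iso: "\<And>z. z \<in> sphere 0 1 \<Longrightarrow> adjoint_mat (G z) ** G z = mat 1"
    and s: "continuous_on (cball 0 1) s" "\<And>z. z \<in> cball 0 1 \<Longrightarrow> s z \<noteq> 0"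
    and M: "continuous_on (cball 0 1) M" "\<And>z c. z \<in> cball 0 1 \<Longrightarrow> M z ** adjoint_mat (M z) \<noteq> mat c"
    and M': "continuous_on (cball 0 1) M'" "\<And>z c. z \<in> cball 0 1 \<Longrightarrow> M' z ** adjoint_mat (M' z) \<noteq> mat c"
    and MM': "\<And>z. z \<in> sphere 0 1 \<Longrightarrow> M z = G z ** M' z ** transpose (G z)"
  shows "\<exists>a. homotopic_with_canon (\<lambda>_. True) (sphere 0 1) (-{0}) (\<lambda>z. G z *v s z) (\<lambda>_. a)"
proof -
  define P where "P L z = top_projector (L z ** adjoint_mat (L z))" for L :: "complex^2 \<Rightarrow> complex^2^2" and z
  have herm: "adjoint_mat (L ** adjoint_mat L) = L ** adjoint_mat L" for L :: "complex^2^2"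
    unfolding adjoint_mat_mult by (simp add: mat2_eq_iff matrix_mul_2)
  have tr: "trace (P L z) = 1" if "\<And>c. L z ** adjoint_mat (L z) \<noteq> mat c" for L z
    using that by (simp add: P_def trace_top_projector herm)
  have *: "\<exists>v. continuous_on (cball 0 1) v \<and> (\<forall>z\<in>cball 0 1. P L z *v v z = v z \<and> v z \<noteq> 0)"
    if L: "continuous_on (cball 0 1) L" "\<And>z c. z \<in> cball 0 1 \<Longrightarrow> L z ** adjoint_mat (L z) \<noteq> mat c" for L
  proof -
    have "continuous_on (cball 0 1) (P L)"
      unfolding P_def [abs_def]
      by (intro continuous_on_top_projector continuous_intros L eigen_gap_nonzero herm) auto
    moreover have "P L z ** P L z = P L z" if "z \<in> cball 0 1" for z
      unfolding P_def by (intro top_projector_idem herm L that)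
    moreover have "P L 0 \<noteq> 0"
      using tr [of L 0] L(2) [of 0] by (auto simp: trace_def)
    ultimately show ?thesis
      by (metis idempotent_field_fixed_section)
  qed
  obtain v where v: "continuous_on (cball 0 1) v"
    "\<And>z. z \<in> cball 0 1 \<Longrightarrow> P M z *v v z = v z" "\<And>z. z \<in> cball 0 1 \<Longrightarrow> v z \<noteq> 0"
    using * [OF M] by metis
  obtain v' where v': "continuous_on (cball 0 1) v'"
    "\<And>z. z \<in> cball 0 1 \<Longrightarrow> P M' z *v v' z = v' z" "\<And>z. z \<in> cball 0 1 \<Longrightarrow> v' z \<noteq> 0"
    using * [OF M'] by metis
  \<comment> \<open>On the sphere \<open>G z *v v' z\<close> and \<open>v z\<close> span the same
    eigenline, so this is their ratio in the form given by \<open>fixed_line\<close>.\<close>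
  define c where "c z = cinner2 (v z) (G z *v v' z) / cinner2 (v z) (v z)" for z
  have c: "G z *v v' z = c z *s v z" if z: "z \<in> sphere 0 1" for z
  proof -
    have zc: "z \<in> cball 0 1" using z by simp
    \<comment> \<open>The second tensor factor contributes \<open>transpose (G z)\<close>, which is
      unitary as well and therefore cancels when \<open>M z\<close> is multiplied by its adjoint;
      only the conjugation by \<open>G z\<close> survives.\<close>
    have GtG: "transpose (G z) ** adjoint_mat (transpose (G z)) = mat 1"
    proof -
      have "transpose (G z) ** adjoint_mat (transpose (G z)) = transpose (adjoint_mat (G z) ** G z)"
        by (simp add: mat2_eq_iff matrix_mul_2 transpose_def mult.commute)
      then show ?thesis by (simp only: iso [OF z]) simp
    qed
    have "M z ** adjoint_mat (M z)
        = G z ** M' z ** (transpose (G z) ** adjoint_mat (transpose (G z))) ** adjoint_mat (M' z) ** adjoint_mat (G z)"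
      unfolding MM' [OF z] adjoint_mat_mult by (simp add: matrix_mul_assoc)
    also have "\<dots> = G z ** (M' z ** adjoint_mat (M' z)) ** adjoint_mat (G z)"
      unfolding GtG by (simp add: matrix_mul_assoc)
    finally have "P M z = G z ** P M' z ** adjoint_mat (G z)"
      unfolding P_def by (simp only: top_projector_conj [OF iso [OF z]])
    then have "P M z *v (G z *v v' z) = G z *v (P M' z *v ((adjoint_mat (G z) ** G z) *v v' z))"
      by (simp add: matrix_vector_mul_assoc matrix_mul_assoc)
    then have "P M z *v (G z *v v' z) = G z *v v' z"
      using iso [OF z] v'(2) [OF zc] by simp
    moreover have "trace (P M z) = 1"
      using tr M(2) zc by blast
    ultimately show ?thesis
      unfolding c_def using fixed_line v zc by blast
  qed
  have c0: "c z \<noteq> 0" if "z \<in> sphere 0 1" for z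
    using c [OF that] isometry_matrix_vec_nonzero [OF iso [OF that] v'(3)] that by auto
  have "continuous_on (sphere 0 1) v" "continuous_on (sphere 0 1) v'"
    using v(1) v'(1) by (auto elim: continuous_on_subset)
  then have "continuous_on (sphere 0 1) c"
    unfolding c_def [abs_def] cinner2_expand
    using v(3) by (intro continuous_intros G)
      (auto simp: cinner2_self_eq_0_iff simp flip: cinner2_expand)
  then obtain l where l: "continuous_on (sphere 0 1) l" "\<And>z. z \<in> sphere 0 1 \<Longrightarrow> c z = exp (l z)"
    using continuous_logarithm_on_sphere [of c] c0 by auto
  have "homotopic_with_canon (\<lambda>_. True) (sphere 0 1) (-{0}) (\<lambda>z. v 0) (\<lambda>z. G z *v v' z)"
  \<comment> \<open>The parameter scales the logarithm and the radius together: at time 0 this is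
    the constant \<open>v 0\<close>, at time 1 it is \<open>c z *s v z\<close>, which equals
    \<open>G z *v v' z\<close>.\<close>
  proof (rule homotopic_canonI [where H = "\<lambda>t z. exp (t *\<^sub>R l z) *s v (t *\<^sub>R z)"])
    have "continuous_on ({0..1} \<times> sphere 0 1) (\<lambda>x. v (fst x *\<^sub>R snd x))"
      by (intro continuous_on_compose2 [OF v(1)] continuous_intros) auto
    moreover have "continuous_on ({0..1::real} \<times> sphere 0 1) (\<lambda>x. l (snd x))"
      by (intro continuous_on_compose2 [OF l(1)] continuous_intros) auto
    ultimately show "continuous_on ({0..1} \<times> sphere 0 1) (\<lambda>(t, z). exp (t *\<^sub>R l z) *s v (t *\<^sub>R z))"
      unfolding case_prod_beta vector_scalar_mult_def
      by (intro continuous_intros)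
    show "exp (t *\<^sub>R l z) *s v (t *\<^sub>R z) \<in> - {0}" if "t \<in> {0..1}" "z \<in> sphere 0 1" for t z
      using that v(3) [of "t *\<^sub>R z"] by auto
  qed (simp_all add: c l)
  then show ?thesis
    using isometry_field_transport_homotopic [OF G iso s v'(1,3)]
    by (meson homotopic_with_sym homotopic_with_trans)
qed

section \<open>Coordinates on the hemispheres\<close>

lemma continuous_map_euclidean_iff_tendsto:
  "continuous_map X euclidean f \<longleftrightarrow> (\<forall>x\<in>topspace X. (f \<longlongrightarrow> f x) (atin X x))"
  by (simp add: continuous_map_atin)

lemma continuous_map_vec_nth [continuous_intros]:
  "continuous_map X euclidean f \<Longrightarrow> continuous_map X euclidean (\<lambda>x. f x $ i)"
  by (simp add: continuous_map_euclidean_iff_tendsto tendsto_vec_nth)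

lemma continuous_map_vec_lambda [continuous_intros]:
  "(\<And>i. continuous_map X euclidean (\<lambda>x. f x i)) \<Longrightarrow> continuous_map X euclidean (\<lambda>x. \<chi> i. f x i)"
  by (simp add: continuous_map_euclidean_iff_tendsto tendsto_vec_lambda)

lemma continuous_map_times [continuous_intros]:
  fixes f g :: "'x \<Rightarrow> 'a::real_normed_algebra"
  shows "continuous_map X euclidean f \<Longrightarrow> continuous_map X euclidean g
    \<Longrightarrow> continuous_map X euclidean (\<lambda>x. f x * g x)"
  by (simp add: continuous_map_euclidean_iff_tendsto tendsto_mult)

lemma continuous_map_cnj [continuous_intros]:
  "continuous_map X euclidean f \<Longrightarrow> continuous_map X euclidean (\<lambda>x. cnj (f x))"
  by (simp add: continuous_map_euclidean_iff_tendsto tendsto_cnj)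

lemma continuous_map_Complex [continuous_intros]:
  "continuous_map X euclidean f \<Longrightarrow> continuous_map X euclidean g
    \<Longrightarrow> continuous_map X euclidean (\<lambda>x. Complex (f x) (g x))"
  by (simp add: continuous_map_euclidean_iff_tendsto tendsto_Complex)

lemma topspace_nsphere_eq: "topspace (nsphere n) = {x. (\<Sum>i\<le>n. (x i)\<^sup>2) = 1 \<and> (\<forall>i>n. x i = 0)}"
  by (simp add: nsphere)

lemma sum_atMost_3: "(\<Sum>i\<le>(3::nat). f i) = f 0 + f 1 + f 2 + f 3"
  for f :: "nat \<Rightarrow> 'a::comm_monoid_add"
  by (simp add: numeral_3_eq_3 numeral_2_eq_2)

lemma sum_atMost_4: "(\<Sum>i\<le>(4::nat). f i) = f 0 + f 1 + f 2 + f 3 + f 4"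
  for f :: "nat \<Rightarrow> 'a::comm_monoid_add"
proof -
  have "{..4::nat} = insert 4 {..3}" by auto
  then show ?thesis by (simp add: sum_atMost_3 add.commute)
qed

text \<open>For \<open>\<sigma>\<close> equal to 1 or -1 this is a closed hemisphere as a graph over
  the unit ball, with inverse \<open>equatorial_projection\<close>. On the unit sphere the root
  vanishes, so both charts agree there.\<close>

definition hemisphere_point :: "real \<Rightarrow> complex^2 \<Rightarrow> nat \<Rightarrow> real" where
  "hemisphere_point \<sigma> z = (\<lambda>i.
     if i = 0 then Re (z $ 1) else if i = 1 then Im (z $ 1)
     else if i = 2 then Re (z $ 2) else if i = 3 then Im (z $ 2)
     else if i = 4 then \<sigma> * sqrt (1 - (norm z)\<^sup>2) else 0)"

definition equatorial_projection :: "(nat \<Rightarrow> real) \<Rightarrow> complex^2" where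
  "equatorial_projection x = (\<chi> i. if i = 1 then Complex (x 0) (x 1) else Complex (x 2) (x 3))"

lemma norm_complex2_sq:
  "(norm (z :: complex^2))\<^sup>2 = (Re (z$1))\<^sup>2 + (Im (z$1))\<^sup>2 + (Re (z$2))\<^sup>2 + (Im (z$2))\<^sup>2"
  by (simp add: norm_vec_def L2_set_def sum_2 cmod_power2)

lemma norm_equatorial_projection_sq:
  "(norm (equatorial_projection x))\<^sup>2 = (x 0)\<^sup>2 + (x 1)\<^sup>2 + (x 2)\<^sup>2 + (x 3)\<^sup>2"
  by (simp add: norm_complex2_sq equatorial_projection_def)

lemma hemisphere_point_in_nsphere:
  assumes "z \<in> cball 0 1" "\<bar>\<sigma>\<bar> = 1"
  shows "hemisphere_point \<sigma> z \<in> topspace (nsphere 4)"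
proof -
  have "(norm z)\<^sup>2 \<le> 1"
    using assms(1) by (simp add: abs_square_le_1)
  moreover have "\<sigma>\<^sup>2 = 1"
    using assms(2) by (metis power2_abs one_power2)
  ultimately have "(\<sigma> * sqrt (1 - (norm z)\<^sup>2))\<^sup>2 = 1 - (norm z)\<^sup>2"
    by (simp add: power_mult_distrib)
  then show ?thesis
    by (simp add: topspace_nsphere_eq sum_atMost_4 hemisphere_point_def norm_complex2_sq)
qed

lemma hemisphere_point_4_sign:
  assumes "z \<in> cball 0 1"
  shows "hemisphere_point 1 z 4 \<ge> 0" "hemisphere_point (-1) z 4 \<le> 0"
  using assms by (simp_all add: hemisphere_point_def abs_square_le_1)

lemma equatorial_projection_in_cball:
  assumes "x \<in> topspace (nsphere 4)"
  shows "equatorial_projection x \<in> cball 0 1"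
proof -
  have "(norm (equatorial_projection x))\<^sup>2 + (x 4)\<^sup>2 = 1"
    using assms by (simp add: norm_equatorial_projection_sq topspace_nsphere_eq sum_atMost_4)
  then have "(norm (equatorial_projection x))\<^sup>2 \<le> 1"
    by (metis le_add_same_cancel1 zero_le_power2)
  then show ?thesis by (simp add: abs_square_le_1)
qed

text \<open>The equation for \<open>x 4\<close> treats both hemispheres at once: it says
  \<open>x 4 \<ge> 0\<close> for \<open>\<sigma> = 1\<close> and \<open>x 4 \<le> 0\<close> for
  \<open>\<sigma> = -1\<close>.\<close>

lemma hemisphere_point_equatorial_projection:
  assumes x: "x \<in> topspace (nsphere 4)" and "x 4 = \<sigma> * \<bar>x 4\<bar>"
  shows "hemisphere_point \<sigma> (equatorial_projection x) = x"
proof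
  have "1 - (norm (equatorial_projection x))\<^sup>2 = (x 4)\<^sup>2"
    using x by (simp add: norm_equatorial_projection_sq topspace_nsphere_eq sum_atMost_4)
  then have *: "\<sigma> * sqrt (1 - (norm (equatorial_projection x))\<^sup>2) = x 4"
    using assms(2) by simp
  fix i
  have "x i = 0" if "i > 4"
    using x that by (simp add: topspace_nsphere_eq)
  moreover have "i = 0 \<or> i = 1 \<or> i = 2 \<or> i = 3 \<or> i = 4 \<or> i > 4" by linarith
  ultimately show "hemisphere_point \<sigma> (equatorial_projection x) i = x i"
    unfolding hemisphere_point_def * by (auto simp: equatorial_projection_def)
qed

lemma continuous_map_equatorial_projection:
  "continuous_map (nsphere n) euclidean equatorial_projection"
  unfolding equatorial_projection_def [abs_def]
proof (rule continuous_map_vec_lambda)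
  show "continuous_map (nsphere n) euclidean
      (\<lambda>x. if i = 1 then Complex (x 0) (x 1) else Complex (x 2) (x 3))" for i :: 2
    by (cases "i = 1") (auto intro!: continuous_map_Complex continuous_map_nsphere_projection)
qed

lemma continuous_map_hemisphere_point:
  assumes "\<bar>\<sigma>\<bar> = 1"
  shows "continuous_map (top_of_set (cball 0 1)) (nsphere 4) (hemisphere_point \<sigma>)"
proof -
  have "continuous_on (cball 0 1) (\<lambda>z. hemisphere_point \<sigma> z i)" for i
    unfolding hemisphere_point_def
    by (cases "i = 0"; cases "i = 1"; cases "i = 2"; cases "i = 3"; cases "i = 4")
      (auto intro!: continuous_intros)
  then show ?thesis
    using hemisphere_point_in_nsphere [OF _ assms]
    unfolding nsphere continuous_map_in_subtopology continuous_map_componentwise_UNIV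
    by (auto simp: topspace_nsphere_eq)
qed

lemma nsphere_3_eq: "topspace (nsphere 3) = {x \<in> topspace (nsphere 4). x 4 = 0}"
proof -
  have "nsphere 3 = subtopology (nsphere 4) {x. x 4 = 0}"
    using subtopology_nsphere_equator [of 3] by simp
  then show ?thesis by auto
qed

lemma equatorial_projection_in_sphere:
  assumes "x \<in> topspace (nsphere 3)"
  shows "equatorial_projection x \<in> sphere 0 1"
proof -
  have "(norm (equatorial_projection x))\<^sup>2 = 1"
    using assms by (simp add: norm_equatorial_projection_sq topspace_nsphere_eq sum_atMost_3)
  then show ?thesis by (simp add: abs_square_eq_1)
qed

lemma hemisphere_point_equator:
  assumes "z \<in> sphere 0 1"
  shows "hemisphere_point \<sigma> z = hemisphere_point \<tau> z"
    and "hemisphere_point \<sigma> z \<in> topspace (nsphere 3)"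
  using assms norm_complex2_sq [of z]
  by (auto simp: hemisphere_point_def topspace_nsphere_eq sum_atMost_3)

lemma continuous_map_sphere_coords:
  "continuous_map (top_of_set (-{0})) (nsphere 3) sphere_coords"
proof -
  have "continuous_on (-{0}) (\<lambda>z. sphere_coords z i)" for i
    unfolding sphere_coords_def
    by (cases "i = 0"; cases "i = 1"; cases "i = 2"; cases "i = 3")
      (auto intro!: continuous_intros)
  moreover have "sphere_coords z \<in> topspace (nsphere 3)" if "z \<noteq> 0" for z
  proof -
    have "(norm z)\<^sup>2 \<noteq> 0" using that by simp
    then show ?thesis
      using norm_complex2_sq [of z]
      by (simp add: sphere_coords_def topspace_nsphere_eq sum_atMost_3 power_divide
          flip: add_divide_distrib)
  qed
  ultimately show ?thesis
    unfolding nsphere continuous_map_in_subtopology continuous_map_componentwise_UNIV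
    by (auto simp: topspace_nsphere_eq)
qed

text \<open>Composition with \<open>equatorial_projection\<close> and \<open>sphere_coords\<close>
  transfers the homotopy to self-maps of \<open>nsphere 3\<close>, where a nullhomotopic map has
  degree 0. Through this the Chern number obstructs null homotopies.\<close>

lemma nullhomotopic_degree_0:
  assumes "homotopic_with_canon (\<lambda>_. True) (sphere 0 1) (-{0}) k (\<lambda>_. a)"
  shows "Brouwer_degree2 3 (\<lambda>x. sphere_coords (k (equatorial_projection x))) = 0"
proof -
  have "continuous_map (nsphere 3) (top_of_set (sphere 0 1)) equatorial_projection"
    using continuous_map_equatorial_projection equatorial_projection_in_sphere
    unfolding continuous_map_in_subtopology by blast
  then have "homotopic_with (\<lambda>_. True) (nsphere 3) (nsphere 3)
      (sphere_coords \<circ> (k \<circ> equatorial_projection)) (sphere_coords \<circ> ((\<lambda>_. a) \<circ> equatorial_projection))"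
    by (intro homotopic_with_compose_continuous_map_left [OF _ continuous_map_sphere_coords]
        homotopic_with_compose_continuous_map_right [OF assms]) auto
  then show ?thesis
    using Brouwer_degree2_nullhomotopic [of 3 "sphere_coords \<circ> (k \<circ> equatorial_projection)" "sphere_coords a"]
    by (simp add: o_def)
qed

section \<open>Frames of a Hermitian bundle along a map\<close>

text \<open>A linear isometry from \<open>\<complex>\<^sup>2\<close> into the fibre. Surjectivity is
  a consequence, obtained in \<open>frame_coords_left_inverse\<close>.\<close>

definition isometric_frame :: "('b, 'e) bundle_data \<Rightarrow> 'b \<Rightarrow> (complex^2 \<Rightarrow> 'e) \<Rightarrow> bool" where
  "isometric_frame A x f \<longleftrightarrow>
     (\<forall>u. f u \<in> fibre A x) \<and> f 0 = vzero A x \<and>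
     (\<forall>u v. f (u + v) = vplus A (f u) (f v)) \<and>
     (\<forall>c u. f (c *s u) = vscale A c (f u)) \<and>
     (\<forall>u v. vinner A (f u) (f v) = cinner2 u v)"

text \<open>A global isometric frame of the pullback of \<open>A\<close> along \<open>p\<close>,
  expressed inside the total space of \<open>A\<close> so that no pullback bundle has to be
  built.\<close>

definition frame_along ::
    "('b, 'e) bundle_data \<Rightarrow> 'x topology \<Rightarrow> ('x \<Rightarrow> 'b) \<Rightarrow> ('x \<Rightarrow> complex^2 \<Rightarrow> 'e) \<Rightarrow> bool" where
  "frame_along A X p F \<longleftrightarrow>
     continuous_map (prod_topology X euclidean) (total A) (\<lambda>(x, u). F x u) \<and>
     (\<forall>x\<in>topspace X. isometric_frame A (p x) (F x))"

lemma isometric_frameD: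
  assumes "isometric_frame A x f"
  shows "f u \<in> fibre A x" "f 0 = vzero A x" "f (u + v) = vplus A (f u) (f v)"
    "f (c *s u) = vscale A c (f u)" "vinner A (f u) (f v) = cinner2 u v"
  using assms by (auto simp: isometric_frame_def)

lemma frame_alongD:
  assumes "frame_along A X p F" "x \<in> topspace X"
  shows "isometric_frame A (p x) (F x)"
  using assms by (auto simp: frame_along_def)

lemma trivialization_frame_along:
  assumes "trivialization A U \<phi>"
  shows "frame_along A (subtopology (base A) U) (\<lambda>x. x) (\<lambda>x u. \<phi> (x, u))"
proof -
  let ?X = "prod_topology (subtopology (base A) U) (euclidean :: (complex^2) topology)"
  have "homeomorphic_map ?X (bundle_over A U) \<phi>" and U: "U \<subseteq> topspace (base A)"
    using assms by (auto simp: trivialization_def)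
  then have \<phi>: "continuous_map ?X (total A) \<phi>"
    unfolding bundle_over_def
    by (meson continuous_map_in_subtopology homeomorphic_imp_continuous_map)
  then have "\<phi> (x, u) \<in> topspace (total A)" if "x \<in> U" for x u
    using that U by (auto simp: continuous_map_def Pi_iff)
  then show ?thesis
    using assms \<phi> unfolding frame_along_def isometric_frame_def trivialization_def fibre_def by simp
qed

lemma trivialization_isometric_frame:
  assumes "trivialization A U \<phi>" "x \<in> U"
  shows "isometric_frame A x (\<lambda>u. \<phi> (x, u))"
  using assms frame_alongD [OF trivialization_frame_along [OF assms(1)], of x]
  by (auto simp: trivialization_def)

lemma trivialization_coordinates:
  assumes "trivialization A U \<phi>"
  obtains \<kappa> where "continuous_map (bundle_over A U) euclidean \<kappa>"
    "\<And>e x. e \<in> fibre A x \<Longrightarrow> x \<in> U \<Longrightarrow> e = \<phi> (x, \<kappa> e)"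
proof -
  let ?X = "prod_topology (subtopology (base A) U) (euclidean :: (complex^2) topology)"
  have \<phi>: "homeomorphic_map ?X (bundle_over A U) \<phi>"
    and pr: "\<And>x u. x \<in> U \<Longrightarrow> proj A (\<phi> (x, u)) = x"
    using assms by (auto simp: trivialization_def)
  obtain g where "homeomorphic_maps ?X (bundle_over A U) \<phi> g"
    using \<phi> homeomorphic_map_maps by blast
  then have g: "continuous_map (bundle_over A U) ?X g"
    "\<And>e. e \<in> topspace (bundle_over A U) \<Longrightarrow> \<phi> (g e) = e"
    by (auto simp: homeomorphic_maps_def)
  show ?thesis
  proof
    show "continuous_map (bundle_over A U) euclidean (snd \<circ> g)"
      using g(1) continuous_map_snd continuous_map_compose by blast
    fix e x assume e: "e \<in> fibre A x" "x \<in> U"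
    then have e': "e \<in> topspace (bundle_over A U)"
      by (auto simp: fibre_def bundle_over_def)
    then have "fst (g e) \<in> U"
      using g(1) by (auto simp: continuous_map_def Pi_iff mem_Times_iff)
    then have "proj A (\<phi> (fst (g e), snd (g e))) = fst (g e)"
      by (rule pr)
    then have "fst (g e) = x"
      using g(2) [OF e'] e(1) by (simp add: fibre_def)
    then show "e = \<phi> (x, (snd \<circ> g) e)"
      using g(2) [OF e'] by (metis comp_apply prod.collapse)
  qed
qed

lemma continuous_map_locally:
  assumes "\<And>x. x \<in> topspace X \<Longrightarrow> \<exists>T. openin X T \<and> x \<in> T \<and> continuous_map (subtopology X T) Y f"
  shows "continuous_map X Y f"
proof (rule pasting_lemma [where I = "{T. openin X T \<and> continuous_map (subtopology X T) Y f}"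
      and T = "\<lambda>T. T" and f = "\<lambda>_. f"])
qed (use assms in auto)

text \<open>Continuity of the Hermitian metric is not among the defining conditions of the bundle.
  It holds because in a local trivialization the metric is \<open>cinner2\<close> of the
  coordinates, which are continuous.\<close>

lemma continuous_map_vinner:
  assumes A: "hermitian_bundle_rank2 A"
    and p: "continuous_map X (base A) p"
    and a: "continuous_map X (total A) a" "\<And>x. x \<in> topspace X \<Longrightarrow> proj A (a x) = p x"
    and b: "continuous_map X (total A) b" "\<And>x. x \<in> topspace X \<Longrightarrow> proj A (b x) = p x"
  shows "continuous_map X euclidean (\<lambda>x. vinner A (a x) (b x))"
proof (rule continuous_map_locally)
  fix x assume x: "x \<in> topspace X"
  then have "p x \<in> topspace (base A)"
    using p by (auto simp: continuous_map_def Pi_iff)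
  then obtain U \<phi> where U: "openin (base A) U" "p x \<in> U" and \<phi>: "trivialization A U \<phi>"
    using A unfolding hermitian_bundle_rank2_def by blast
  obtain \<kappa> where \<kappa>: "continuous_map (bundle_over A U) euclidean \<kappa>"
    "\<And>e x. e \<in> fibre A x \<Longrightarrow> x \<in> U \<Longrightarrow> e = \<phi> (x, \<kappa> e)"
    using trivialization_coordinates [OF \<phi>] by blast
  define T where "T = {x \<in> topspace X. p x \<in> U}"
  have coord: "continuous_map (subtopology X T) euclidean (\<kappa> \<circ> c)"
    "\<And>y. y \<in> T \<Longrightarrow> c y = \<phi> (p y, \<kappa> (c y))"
    if c: "continuous_map X (total A) c" "\<And>x. x \<in> topspace X \<Longrightarrow> proj A (c x) = p x" for c
  proof -
    have "continuous_map (subtopology X T) (bundle_over A U) c"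
      using c unfolding bundle_over_def T_def
      by (auto simp: continuous_map_in_subtopology continuous_map_from_subtopology)
    then show "continuous_map (subtopology X T) euclidean (\<kappa> \<circ> c)"
      using \<kappa>(1) continuous_map_compose by blast
    have "c y \<in> fibre A (p y)" if "y \<in> T" for y
      using that c by (auto simp: T_def fibre_def continuous_map_def Pi_iff)
    then show "\<And>y. y \<in> T \<Longrightarrow> c y = \<phi> (p y, \<kappa> (c y))"
      using \<kappa>(2) T_def by blast
  qed
  have "continuous_map (subtopology X T) euclidean (\<lambda>y. cinner2 ((\<kappa> \<circ> a) y) ((\<kappa> \<circ> b) y))"
    unfolding cinner2_expand
    by (intro continuous_intros coord a b)
  moreover have "vinner A (a y) (b y) = cinner2 ((\<kappa> \<circ> a) y) ((\<kappa> \<circ> b) y)" if "y \<in> T" for y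
    using that coord(2) [OF a] coord(2) [OF b] isometric_frameD(5) [OF trivialization_isometric_frame [OF \<phi>]]
    by (metis (mono_tags, lifting) T_def comp_apply mem_Collect_eq)
  ultimately have "continuous_map (subtopology X T) euclidean (\<lambda>y. vinner A (a y) (b y))"
    by (elim continuous_map_eq) auto
  moreover have "openin X T"
    unfolding T_def using openin_continuous_map_preimage [OF p U(1)] .
  ultimately show "\<exists>T. openin X T \<and> x \<in> T \<and> continuous_map (subtopology X T) euclidean (\<lambda>x. vinner A (a x) (b x))"
    using x U(2) T_def by blast
qed

section \<open>Coordinates and transition matrices\<close>

definition frame_coords :: "('b, 'e) bundle_data \<Rightarrow> (complex^2 \<Rightarrow> 'e) \<Rightarrow> 'e \<Rightarrow> complex^2" where
  "frame_coords A f e = (\<chi> i. vinner A (f (axis i 1)) e)"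

text \<open>The transition matrix: it takes coordinates with respect to \<open>f'\<close> to
  coordinates with respect to \<open>f\<close>. Like \<open>frame_coords\<close> it is built from
  inner products, so its continuity reduces to \<open>continuous_map_vinner\<close>.\<close>

definition frame_ratio ::
    "('b, 'e) bundle_data \<Rightarrow> (complex^2 \<Rightarrow> 'e) \<Rightarrow> (complex^2 \<Rightarrow> 'e) \<Rightarrow> complex^2^2" where
  "frame_ratio A f f' = (\<chi> i j. vinner A (f (axis i 1)) (f' (axis j 1)))"

lemma cinner2_axis: "cinner2 (axis i 1) u = u $ i"
  using exhaust_2 [of i] by (auto simp: cinner2_expand axis_def)

lemma vec2_axis_expand: "(u :: complex^2) = u$1 *s axis 1 1 + u$2 *s axis 2 1"
  by (simp add: vec2_eq_iff axis_def)

lemma frame_coords_frame: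
  assumes "isometric_frame A x f"
  shows "frame_coords A f (f u) = u"
  using isometric_frameD(5) [OF assms] by (simp add: frame_coords_def cinner2_axis)

text \<open>What has to be shown is that \<open>f\<close> is onto. The frame \<open>h\<close> of a
  local trivialization is onto, and \<open>f\<close> is \<open>h\<close> composed with a matrix
  \<open>K\<close>. As both are isometries, \<open>K\<close> is unitary, so \<open>h\<close> factors
  through \<open>f\<close>.\<close>

lemma frame_coords_left_inverse:
  assumes A: "hermitian_bundle_rank2 A" and x: "x \<in> topspace (base A)"
    and f: "isometric_frame A x f" and e: "e \<in> fibre A x"
  shows "f (frame_coords A f e) = e"
proof -
  obtain U \<phi> where U: "openin (base A) U" "x \<in> U" and \<phi>: "trivialization A U \<phi>"
    using A x unfolding hermitian_bundle_rank2_def by blast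
  obtain \<kappa> where \<kappa>: "\<And>e. e \<in> fibre A x \<Longrightarrow> e = \<phi> (x, \<kappa> e)"
    using trivialization_coordinates [OF \<phi>] U(2) by metis
  define h where "h u = \<phi> (x, u)" for u
  have h: "isometric_frame A x h"
    unfolding h_def [abs_def] by (rule trivialization_isometric_frame [OF \<phi> U(2)])
  have h_coords: "h (frame_coords A h e) = e" if "e \<in> fibre A x" for e
    using \<kappa> [OF that] frame_coords_frame [OF h] by (metis h_def)
  define K :: "complex^2^2" where "K = (\<chi> i j. frame_coords A h (f (axis j 1)) $ i)"
  have fh: "f u = h (K *v u)" for u
  proof -
    have ax: "f (axis j 1) = h (frame_coords A h (f (axis j 1)))" for j
      using h_coords isometric_frameD(1) [OF f] by metis
    have "f u = vplus A (vscale A (u$1) (f (axis 1 1))) (vscale A (u$2) (f (axis 2 1)))"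
      using vec2_axis_expand [of u] isometric_frameD(3,4) [OF f] by metis
    also have "\<dots> = h (u$1 *s frame_coords A h (f (axis 1 1)) + u$2 *s frame_coords A h (f (axis 2 1)))"
      using ax isometric_frameD(3,4) [OF h] by metis
    also have "u$1 *s frame_coords A h (f (axis 1 1)) + u$2 *s frame_coords A h (f (axis 2 1)) = K *v u"
      by (simp add: vec2_eq_iff K_def matrix_vec_2)
    finally show ?thesis .
  qed
  have "adjoint_mat K ** K = mat 1"
    using isometric_frameD(5) [OF f] isometric_frameD(5) [OF h] fh
    by (metis isometry_matrix_iff)
  then have "K ** adjoint_mat K = mat 1"
    by (simp add: matrix_left_right_inverse)
  then have "h w = f (adjoint_mat K *v w)" for w
    by (simp add: fh matrix_vector_mul_assoc)
  then show ?thesis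
    using h_coords [OF e] frame_coords_frame [OF f] by metis
qed

lemma
  assumes A: "hermitian_bundle_rank2 A" and x: "x \<in> topspace (base A)"
    and f: "isometric_frame A x f" and f': "isometric_frame A x f'"
  shows frame_ratio: "f' u = f (frame_ratio A f f' *v u)"
    and frame_ratio_isometry: "adjoint_mat (frame_ratio A f f') ** frame_ratio A f f' = mat 1"
proof -
  have ratio: "f' u = f (frame_ratio A f f' *v u)" for u
  proof -
    have ax: "f' (axis j 1) = f (frame_coords A f (f' (axis j 1)))" for j
      using frame_coords_left_inverse [OF A x f] isometric_frameD(1) [OF f'] by metis
    have "f' u = vplus A (vscale A (u$1) (f' (axis 1 1))) (vscale A (u$2) (f' (axis 2 1)))"
      using vec2_axis_expand [of u] isometric_frameD(3,4) [OF f'] by metis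
    also have "\<dots> = f (u$1 *s frame_coords A f (f' (axis 1 1)) + u$2 *s frame_coords A f (f' (axis 2 1)))"
      using ax isometric_frameD(3,4) [OF f] by metis
    also have "u$1 *s frame_coords A f (f' (axis 1 1)) + u$2 *s frame_coords A f (f' (axis 2 1))
        = frame_ratio A f f' *v u"
      by (simp add: vec2_eq_iff frame_ratio_def frame_coords_def matrix_vec_2)
    finally show ?thesis .
  qed
  then show "f' u = f (frame_ratio A f f' *v u)" .
  show "adjoint_mat (frame_ratio A f f') ** frame_ratio A f f' = mat 1"
    using isometric_frameD(5) [OF f] isometric_frameD(5) [OF f'] ratio
    by (metis isometry_matrix_iff)
qed

lemma isometric_frame_change:
  assumes f: "isometric_frame A x f" and K: "adjoint_mat K ** K = mat 1"
  shows "isometric_frame A x (\<lambda>u. f (K *v u))"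
  using isometric_frameD [OF f] isometry_matrix_iff [of K] K
  unfolding isometric_frame_def
  by (simp add: matrix_vector_right_distrib vector_scalar_commute)

lemma continuous_map_frame_apply:
  assumes "frame_along A X p F" and h: "continuous_map Y X h" and u: "continuous_map Y euclidean u"
  shows "continuous_map Y (total A) (\<lambda>y. F (h y) (u y))"
proof -
  have "continuous_map Y (prod_topology X euclidean) (\<lambda>y. (h y, u y))"
    using h u by (simp add: continuous_map_pairedI)
  from continuous_map_compose [OF this] assms(1) show ?thesis
    unfolding frame_along_def by (fastforce simp: o_def)
qed

lemma frame_along_change:
  assumes F: "frame_along A X p F" and K: "continuous_map X euclidean K"
    and iso: "\<And>x. x \<in> topspace X \<Longrightarrow> adjoint_mat (K x) ** K x = mat 1"
  shows "frame_along A X p (\<lambda>x u. F x (K x *v u))"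
  unfolding frame_along_def
proof
  have "continuous_map (prod_topology X euclidean) euclidean (\<lambda>y. K (fst y) *v snd y)"
    unfolding matrix_vector_mult_def
    by (intro continuous_intros continuous_map_sum continuous_map_vec_nth
        continuous_map_compose [OF continuous_map_fst K, unfolded o_def] continuous_map_snd) auto
  from continuous_map_frame_apply [OF F continuous_map_fst this]
  show "continuous_map (prod_topology X euclidean) (total A) (\<lambda>(x, u). F x (K x *v u))"
    by (simp only: case_prod_unfold)
  show "\<forall>x\<in>topspace X. isometric_frame A (p x) (\<lambda>u. F x (K x *v u))"
    by (intro ballI isometric_frame_change frame_alongD [OF F] iso)
qed

lemma frame_along_compose:
  assumes F: "frame_along A X p F" and h: "continuous_map Y X h"
  shows "frame_along A Y (\<lambda>y. p (h y)) (\<lambda>y. F (h y))"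
  unfolding frame_along_def
proof
  show "continuous_map (prod_topology Y euclidean) (total A) (\<lambda>(y, u). F (h y) u)"
    using continuous_map_frame_apply [OF F continuous_map_compose [OF continuous_map_fst h] continuous_map_snd]
    by (simp only: case_prod_unfold o_def)
  show "\<forall>y\<in>topspace Y. isometric_frame A (p (h y)) (F (h y))"
    using frame_alongD [OF F] h by (auto simp: continuous_map_def Pi_iff)
qed

lemma continuous_map_frame_ratio:
  assumes A: "hermitian_bundle_rank2 A" and p: "continuous_map X (base A) p"
    and F: "frame_along A X p F" and F': "frame_along A X p F'"
  shows "continuous_map X euclidean (\<lambda>x. frame_ratio A (F x) (F' x))"
  unfolding frame_ratio_def
proof (intro continuous_map_vec_lambda continuous_map_vinner [OF A p])
  show "continuous_map X (total A) (\<lambda>x. F x (axis i 1))" "continuous_map X (total A) (\<lambda>x. F' x (axis i 1))" for i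
    using continuous_map_frame_apply [OF F continuous_map_id [unfolded id_def]]
      continuous_map_frame_apply [OF F' continuous_map_id [unfolded id_def]] by auto
qed (use frame_alongD [OF F] frame_alongD [OF F'] in \<open>auto simp: isometric_frame_def fibre_def\<close>)

lemma frame_along_glue:
  assumes ST: "closedin X S" "closedin X T" "topspace X \<subseteq> S \<union> T"
    and F: "frame_along A (subtopology X S) p F" and F': "frame_along A (subtopology X T) p F'"
    and eq: "\<And>x. x \<in> S \<inter> T \<Longrightarrow> F x = F' x"
  shows "frame_along A X p (\<lambda>x. if x \<in> S then F x else F' x)"
  unfolding frame_along_def
proof
  let ?X = "prod_topology X (euclidean :: (complex^2) topology)"
  show "continuous_map ?X (total A) (\<lambda>(x, u). (if x \<in> S then F x else F' x) u)"
  proof (rule pasting_lemma_closed [where I = "{True, False}" and T = "\<lambda>i. (if i then S else T) \<times> UNIV"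
        and f = "\<lambda>i (x, u). if i then F x u else F' x u"])
    show "closedin ?X ((if i then S else T) \<times> UNIV)" for i
      using ST by (auto simp: closedin_prod_Times_iff)
    have "subtopology ?X (R \<times> UNIV) = prod_topology (subtopology X R) euclidean" for R
      by (simp add: prod_topology_subtopology)
    then show "continuous_map (subtopology ?X ((if i then S else T) \<times> UNIV)) (total A)
        (\<lambda>(x, u). if i then F x u else F' x u)" for i
      using F F' by (cases i) (simp_all add: frame_along_def)
    show "(\<lambda>(x, u). if i then F x u else F' x u) y = (\<lambda>(x, u). if j then F x u else F' x u) y"
      if "y \<in> topspace ?X \<inter> (if i then S else T) \<times> UNIV \<inter> (if j then S else T) \<times> UNIV" for i j y
      using that eq [of "fst y"] by (cases i; cases j) auto
    show "\<exists>j. j \<in> {True, False} \<and> y \<in> (if j then S else T) \<times> UNIV \<and>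
        (\<lambda>(x, u). (if x \<in> S then F x else F' x) u) y = (\<lambda>(x, u). if j then F x u else F' x u) y"
      if "y \<in> topspace ?X" for y
      using that ST(3) by (intro exI [of _ "fst y \<in> S"]) auto
  qed simp
  show "\<forall>x\<in>topspace X. isometric_frame A (p x) (if x \<in> S then F x else F' x)"
    using ST(3) frame_alongD [OF F] frame_alongD [OF F'] by auto
qed

section \<open>Triviality over boxes and balls\<close>

lemma continuous_map_topspace:
  "continuous_map X Y f \<Longrightarrow> x \<in> topspace X \<Longrightarrow> f x \<in> topspace Y"
  by (auto simp: continuous_map_def Pi_iff)

text \<open>The transition matrix on the wall is extended constantly in the direction \<open>j\<close>.\<close>

lemma frame_along_join:
  fixes a b :: "'a::euclidean_space"
  assumes A: "hermitian_bundle_rank2 A" and p: "continuous_map (top_of_set (cbox a b)) (base A) p"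
    and j: "j \<in> Basis" and c: "a \<bullet> j \<le> c" "c \<le> b \<bullet> j"
    and F: "frame_along A (top_of_set (cbox a b \<inter> {x. x \<bullet> j \<le> c})) p F"
    and F': "frame_along A (top_of_set (cbox a b \<inter> {x. x \<bullet> j \<ge> c})) p F'"
  shows "\<exists>F. frame_along A (top_of_set (cbox a b)) p F"
proof -
  define W where "W = cbox a b \<inter> {x. x \<bullet> j = c}"
  define \<rho> where "\<rho> x = x + (c - x \<bullet> j) *\<^sub>R j" for x
  define K where "K x = frame_ratio A (F' x) (F x)" for x
  have restrict: "frame_along A (top_of_set W) p L"
    if "frame_along A (top_of_set S) p L" "W \<subseteq> S" for L S
    using frame_along_compose [OF that(1), of "top_of_set W" "\<lambda>x. x"] that(2) by auto
  have WF: "frame_along A (top_of_set W) p F" "frame_along A (top_of_set W) p F'"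
    by (rule restrict [OF F], force simp: W_def) (rule restrict [OF F'], force simp: W_def)
  have Wp: "continuous_map (top_of_set W) (base A) p"
    by (rule continuous_map_from_subtopology_mono [OF p]) (auto simp: W_def)
  have base: "p x \<in> topspace (base A)" if "x \<in> W" for x
    using continuous_map_topspace [OF Wp] that by simp
  have K: "adjoint_mat (K x) ** K x = mat 1" "F x u = F' x (K x *v u)" if "x \<in> W" for x u
    using frame_ratio [OF A base [OF that]] frame_ratio_isometry [OF A base [OF that]]
      frame_alongD [OF WF(1)] frame_alongD [OF WF(2)] that by (auto simp: K_def)
  have "\<rho> x \<in> W" if "x \<in> cbox a b" for x
    using that j c by (auto simp: W_def \<rho>_def mem_box inner_add_left inner_diff_left inner_Basis)
  then have \<rho>: "continuous_map (top_of_set (cbox a b \<inter> {x. x \<bullet> j \<ge> c})) (top_of_set W) \<rho>"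
    unfolding \<rho>_def [abs_def] by (auto simp: continuous_map_in_subtopology intro!: continuous_intros)
  have "continuous_map (top_of_set (cbox a b \<inter> {x. x \<bullet> j \<ge> c})) euclidean (\<lambda>x. K (\<rho> x))"
    using continuous_map_compose [OF \<rho> continuous_map_frame_ratio [OF A Wp WF(2,1)]]
    by (simp only: o_def K_def)
  then have G: "frame_along A (top_of_set (cbox a b \<inter> {x. x \<bullet> j \<ge> c})) p (\<lambda>x u. F' x (K (\<rho> x) *v u))"
    by (rule frame_along_change [OF F']) (use continuous_map_topspace [OF \<rho>] K(1) in auto)
  have "frame_along A (top_of_set (cbox a b)) p
      (\<lambda>x. if x \<in> cbox a b \<inter> {x. x \<bullet> j \<le> c} then F x else (\<lambda>u. F' x (K (\<rho> x) *v u)))"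
  proof (rule frame_along_glue)
    show "closedin (top_of_set (cbox a b)) (cbox a b \<inter> {x. x \<bullet> j \<le> c})"
      "closedin (top_of_set (cbox a b)) (cbox a b \<inter> {x. x \<bullet> j \<ge> c})"
      by (auto intro!: closed_subset closed_Int closed_cbox closed_halfspace_component_le
          closed_halfspace_component_ge)
    show "F x = (\<lambda>u. F' x (K (\<rho> x) *v u))"
      if "x \<in> (cbox a b \<inter> {x. x \<bullet> j \<le> c}) \<inter> (cbox a b \<inter> {x. x \<bullet> j \<ge> c})" for x
    proof -
      have "x \<in> W" "\<rho> x = x" using that by (auto simp: W_def \<rho>_def)
      then show ?thesis using K(2) by auto
    qed
  qed (use F G in \<open>auto simp: subtopology_subtopology Int_absorb1\<close>)
  then show ?thesis by blast
qed

text \<open>\<open>\<epsilon>\<close> is a Lebesgue number for the cover of \<open>Q\<close> by open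
  sets whose points in \<open>Q\<close> are mapped by \<open>p\<close> into the domain of one
  trivialization.\<close>

lemma frame_along_small:
  fixes Q :: "'a::euclidean_space set"
  assumes A: "hermitian_bundle_rank2 A" and "compact Q" and p: "continuous_map (top_of_set Q) (base A) p"
  obtains \<epsilon> where "\<epsilon> > 0"
    "\<And>S x. S \<subseteq> Q \<Longrightarrow> x \<in> Q \<Longrightarrow> S \<subseteq> ball x \<epsilon> \<Longrightarrow> \<exists>F. frame_along A (top_of_set S) p F"
proof -
  define \<G> where "\<G> = {G. open G \<and> (\<exists>U \<phi>. trivialization A U \<phi> \<and> p ` (Q \<inter> G) \<subseteq> U)}"
  have "Q \<subseteq> \<Union>\<G>"
  proof
    fix x assume x: "x \<in> Q"
    then have "p x \<in> topspace (base A)"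
      using continuous_map_topspace [OF p] by simp
    then obtain U \<phi> where U: "openin (base A) U" "p x \<in> U" and \<phi>: "trivialization A U \<phi>"
      using A unfolding hermitian_bundle_rank2_def by blast
    have "openin (top_of_set Q) {x \<in> Q. p x \<in> U}"
      using openin_continuous_map_preimage [OF p U(1)] by simp
    then obtain G where "open G" "{x \<in> Q. p x \<in> U} = Q \<inter> G"
      by (auto simp: openin_open)
    then show "x \<in> \<Union>\<G>"
    proof -
      have "p ` (Q \<inter> G) \<subseteq> U" "x \<in> G"
        using \<open>{x \<in> Q. p x \<in> U} = Q \<inter> G\<close> x U(2) by auto
      then show ?thesis
        unfolding \<G>_def using \<open>open G\<close> \<phi> by auto
    qed
  qed
  then obtain \<epsilon> where \<epsilon>: "\<epsilon> > 0" "\<And>x. x \<in> Q \<Longrightarrow> \<exists>G\<in>\<G>. ball x \<epsilon> \<subseteq> G"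
    using Heine_Borel_lemma [OF \<open>compact Q\<close>, of \<G>] unfolding \<G>_def by blast
  show ?thesis
  proof
    fix S x assume S: "S \<subseteq> Q" "x \<in> Q" "S \<subseteq> ball x \<epsilon>"
    obtain G where "G \<in> \<G>" and G: "ball x \<epsilon> \<subseteq> G"
      using \<epsilon>(2) [OF S(2)] by blast
    then obtain U \<phi> where \<phi>: "trivialization A U \<phi>" and U: "p ` (Q \<inter> G) \<subseteq> U"
      unfolding \<G>_def by auto
    have "p ` S \<subseteq> U" using S G U by blast
    then have "continuous_map (top_of_set S) (subtopology (base A) U) p"
      using continuous_map_from_subtopology_mono [OF p S(1)] by (auto simp: continuous_map_in_subtopology)
    from frame_along_compose [OF trivialization_frame_along [OF \<phi>] this]
    show "\<exists>F. frame_along A (top_of_set S) p F" by blast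
  qed (rule \<epsilon>)
qed

text \<open>A double induction. The outer one is on the set \<open>T\<close> of directions in which
  the box may be longer than \<open>\<eta>\<close>; the inner one is on the number \<open>n\<close>
  of slabs of width \<open>\<eta>\<close> that cover it in the direction \<open>j\<close> just
  added. Slabs are assembled with \<open>frame_along_join\<close>.\<close>

lemma frame_along_cbox:
  fixes a b :: "'a::euclidean_space"
  assumes A: "hermitian_bundle_rank2 A" and p: "continuous_map (top_of_set (cbox a b)) (base A) p"
  shows "\<exists>F. frame_along A (top_of_set (cbox a b)) p F"
proof -
  obtain \<epsilon> where \<epsilon>: "\<epsilon> > 0" "\<And>S x. S \<subseteq> cbox a b \<Longrightarrow> x \<in> cbox a b \<Longrightarrow> S \<subseteq> ball x \<epsilon>
      \<Longrightarrow> \<exists>F. frame_along A (top_of_set S) p F"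
    using frame_along_small [OF A compact_cbox p] by blast
  \<comment> \<open>If all sides are at most \<open>\<eta>\<close>, the coordinate differences from
    the corner \<open>c\<close> add up to at most \<open>\<epsilon> / 2\<close>, so the box lies in
    \<open>ball c \<epsilon>\<close>.\<close>
  define \<eta> where "\<eta> = \<epsilon> / (2 * DIM('a))"
  have \<eta>: "\<eta> > 0" using \<epsilon>(1) by (simp add: \<eta>_def)
  have good: "\<exists>F. frame_along A (top_of_set (cbox c d)) p F"
    if "finite T" "T \<subseteq> Basis" "cbox c d \<subseteq> cbox a b" "\<forall>i\<in>Basis - T. (d - c) \<bullet> i \<le> \<eta>" for T c d
    using that
  proof (induction T arbitrary: c d rule: finite_induct)
    case empty
    show ?case
    proof (cases "cbox c d = {}")
      case True
      then show ?thesis using \<epsilon>(2) [of "{}" a] \<epsilon>(2) [of "cbox c d"] empty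
        by (auto simp: frame_along_def prod_topology_trivial_iff)
    next
      case False
      then have c: "c \<in> cbox c d" by (simp add: box_ne_empty mem_box)
      have "cbox c d \<subseteq> ball c \<epsilon>"
      proof
        fix y assume y: "y \<in> cbox c d"
        have "norm (y - c) \<le> (\<Sum>i\<in>Basis. \<bar>(y - c) \<bullet> i\<bar>)"
          by (rule norm_le_l1)
        also have "\<dots> \<le> (\<Sum>i\<in>(Basis::'a set). \<eta>)"
        proof (rule sum_mono)
          fix i :: 'a assume "i \<in> Basis"
          then show "\<bar>(y - c) \<bullet> i\<bar> \<le> \<eta>"
            using y empty.prems(3) by (fastforce simp: mem_box inner_diff_left)
        qed
        also have "\<dots> = \<epsilon> / 2" by (simp add: \<eta>_def)
        also have "\<dots> < \<epsilon>" using \<epsilon>(1) by simp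
        finally show "y \<in> ball c \<epsilon>" by (simp add: dist_norm norm_minus_commute)
      qed
      then show ?thesis using \<epsilon>(2) empty.prems(2) c by blast
    qed
  next
    case (insert j T)
    then have j: "j \<in> Basis" by simp
    have "\<exists>F. frame_along A (top_of_set (cbox c d)) p F"
      if "(d - c) \<bullet> j \<le> real n * \<eta>" "cbox c d \<subseteq> cbox a b" "\<forall>i\<in>Basis - insert j T. (d - c) \<bullet> i \<le> \<eta>" for n c d
      using that
    proof (induction n arbitrary: c d)
      case 0
      then have "\<forall>i\<in>Basis - T. (d - c) \<bullet> i \<le> \<eta>"
        using \<eta> by (metis Diff_iff insert_iff less_eq_real_def mult_zero_left of_nat_0 order_trans)
      then show ?case using insert 0 by auto
    next
      case (Suc n)
      show ?case
      proof (cases "(d - c) \<bullet> j \<le> \<eta>")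
        case True
        then have "\<forall>i\<in>Basis - T. (d - c) \<bullet> i \<le> \<eta>"
          using Suc.prems by auto
        then show ?thesis using insert Suc.prems by auto
      next
        case False
        \<comment> \<open>A slab of width exactly \<open>\<eta>\<close> is cut off at the lower end.
          It is short in direction \<open>j\<close> and falls under the outer induction hypothesis;
          the rest needs only \<open>n\<close> slabs.\<close>
        define m where "m = c \<bullet> j + \<eta>"
        have m: "c \<bullet> j \<le> m" "m \<le> d \<bullet> j"
          using False \<eta> by (auto simp: m_def inner_diff_left)
        define d' c' where "d' = (\<Sum>i\<in>Basis. (if i = j then min (d\<bullet>j) m else d\<bullet>i) *\<^sub>R i)"
          and "c' = (\<Sum>i\<in>Basis. (if i = j then max (c\<bullet>j) m else c\<bullet>i) *\<^sub>R i)"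
        have split: "cbox c d \<inter> {x. x \<bullet> j \<le> m} = cbox c d'" "cbox c d \<inter> {x. x \<bullet> j \<ge> m} = cbox c' d"
          unfolding d'_def c'_def by (rule interval_split [OF j])+
        have d': "d' \<bullet> i = (if i = j then m else d \<bullet> i)" if "i \<in> Basis" for i
          using that m by (simp add: d'_def)
        have c': "c' \<bullet> i = (if i = j then m else c \<bullet> i)" if "i \<in> Basis" for i
          using that m by (simp add: c'_def)
        have "\<exists>F. frame_along A (top_of_set (cbox c d')) p F"
        proof (rule insert.IH)
          show "cbox c d' \<subseteq> cbox a b" using split Suc.prems(2) by blast
          show "\<forall>i\<in>Basis - T. (d' - c) \<bullet> i \<le> \<eta>"
            using Suc.prems(3) by (auto simp: inner_diff_left d' m_def)
        qed (use insert.prems in auto)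
        moreover have "\<exists>F. frame_along A (top_of_set (cbox c' d)) p F"
        proof (rule Suc.IH)
          show "cbox c' d \<subseteq> cbox a b" using split Suc.prems(2) by blast
          show "(d - c') \<bullet> j \<le> real n * \<eta>"
            using Suc.prems(1) by (simp add: inner_diff_left c' j m_def algebra_simps)
          show "\<forall>i\<in>Basis - insert j T. (d - c') \<bullet> i \<le> \<eta>"
            using Suc.prems(3) by (auto simp: inner_diff_left c')
        qed
        moreover have "continuous_map (top_of_set (cbox c d)) (base A) p"
          using continuous_map_from_subtopology_mono [OF p Suc.prems(2)] .
        ultimately show ?thesis
          using frame_along_join [OF A _ j m] unfolding split by blast
      qed
    qed
    moreover obtain n where "(d - c) \<bullet> j \<le> real n * \<eta>"
      using \<eta> real_arch_simple [of "(d - c) \<bullet> j / \<eta>"] by (auto simp: field_simps)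
    ultimately show ?case using insert.prems by blast
  qed
  show ?thesis by (rule good [of Basis]) auto
qed

text \<open>The closest-point retraction extends \<open>p\<close> from the ball to an enclosing box,
  where a frame exists; its restriction to the ball is a frame along \<open>p\<close>.\<close>

lemma frame_along_cball:
  fixes c :: "'a::euclidean_space"
  assumes A: "hermitian_bundle_rank2 A" and p: "continuous_map (top_of_set (cball c r)) (base A) p" and r: "r \<ge> 0"
  shows "\<exists>F. frame_along A (top_of_set (cball c r)) p F"
proof -
  obtain a b where ab: "cball c r \<subseteq> cbox a b"
    using bounded_cball bounded_subset_cbox_symmetric by metis
  define h where "h = closest_point (cball c r)"
  have "continuous_map (top_of_set (cbox a b)) (top_of_set (cball c r)) h"
    using r closest_point_in_set [of "cball c r"]
    by (auto simp: h_def continuous_map_in_subtopology intro!: continuous_on_closest_point)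
  from continuous_map_compose [OF this p]
  have "continuous_map (top_of_set (cbox a b)) (base A) (\<lambda>x. p (h x))" by (simp add: o_def)
  then obtain F where "frame_along A (top_of_set (cbox a b)) (\<lambda>x. p (h x)) F"
    using frame_along_cbox [OF A] by blast
  from frame_along_compose [OF this, of "top_of_set (cball c r)" "\<lambda>x. x"] ab
  have "frame_along A (top_of_set (cball c r)) (\<lambda>x. p (h x)) F" by auto
  moreover have "h x = x" if "x \<in> cball c r" for x
    unfolding h_def by (rule closest_point_self [OF that])
  ultimately show ?thesis
    unfolding frame_along_def by auto
qed

section \<open>Tensors in frames\<close>

definition coord_functional ::
    "('b, 'e) bundle_data \<Rightarrow> 'b \<Rightarrow> (complex^2 \<Rightarrow> 'e) \<Rightarrow> 2 \<Rightarrow> 'e \<Rightarrow> complex" where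
  "coord_functional A x f i = (\<lambda>e. if e \<in> fibre A x then frame_coords A f e $ i else 0)"

text \<open>The functionals \<open>coord_functional\<close> form the dual basis, so evaluating on
  them reads off the coefficients of \<open>t\<close> in the products of frame vectors.\<close>

definition tensor_matrix ::
    "('b, 'e) bundle_data \<Rightarrow> 'b \<Rightarrow> (complex^2 \<Rightarrow> 'e) \<Rightarrow> 'e tensor2 \<Rightarrow> complex^2^2" where
  "tensor_matrix A x f t = (\<chi> i j. t (coord_functional A x f i) (coord_functional A x f j))"

lemma dual_fibre_frame:
  assumes f: "isometric_frame A x f" and \<alpha>: "\<alpha> \<in> dual_fibre A x"
  shows "\<alpha> (f u) = u$1 * \<alpha> (f (axis 1 1)) + u$2 * \<alpha> (f (axis 2 1))"
proof -
  have "\<alpha> (f u) = \<alpha> (vplus A (vscale A (u$1) (f (axis 1 1))) (vscale A (u$2) (f (axis 2 1))))"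
    using vec2_axis_expand [of u] isometric_frameD(3,4) [OF f] by metis
  moreover have "vscale A c (f v) \<in> fibre A x" for c v
    using isometric_frameD(1,4) [OF f] by metis
  ultimately show ?thesis
    using \<alpha> isometric_frameD(1) [OF f] unfolding dual_fibre_def by simp
qed

lemma dual_fibre_add: "\<alpha> \<in> dual_fibre A x \<Longrightarrow> \<beta> \<in> dual_fibre A x \<Longrightarrow> (\<lambda>u. \<alpha> u + \<beta> u) \<in> dual_fibre A x"
  unfolding dual_fibre_def by (simp add: algebra_simps)

lemma dual_fibre_scale: "\<alpha> \<in> dual_fibre A x \<Longrightarrow> (\<lambda>u. c * \<alpha> u) \<in> dual_fibre A x"
  unfolding dual_fibre_def by (simp add: algebra_simps)

lemma tensor_in_tensor_fibre:
  "tensor A x v w \<in> tensor_fibre A x"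
  unfolding tensor_fibre_def tensor_def
  by (auto simp: dual_fibre_add dual_fibre_scale algebra_simps)

lemma tensor_fibre_lincomb:
  assumes "t \<in> tensor_fibre A x" "\<alpha> \<in> dual_fibre A x" "\<alpha>' \<in> dual_fibre A x" "\<beta> \<in> dual_fibre A x"
  shows "t (\<lambda>u. a * \<alpha> u + a' * \<alpha>' u) \<beta> = a * t \<alpha> \<beta> + a' * t \<alpha>' \<beta>"
    and "t \<beta> (\<lambda>u. a * \<alpha> u + a' * \<alpha>' u) = a * t \<beta> \<alpha> + a' * t \<beta> \<alpha>'"
proof -
  have add: "t (\<lambda>u. \<alpha> u + \<alpha>' u) \<beta> = t \<alpha> \<beta> + t \<alpha>' \<beta>" "t \<beta> (\<lambda>u. \<alpha> u + \<alpha>' u) = t \<beta> \<alpha> + t \<beta> \<alpha>'"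
    if "\<alpha> \<in> dual_fibre A x" "\<alpha>' \<in> dual_fibre A x" for \<alpha> \<alpha>'
    using assms(1,4) that unfolding tensor_fibre_def by blast+
  have scale: "t (\<lambda>u. c * \<alpha> u) \<beta> = c * t \<alpha> \<beta>" "t \<beta> (\<lambda>u. c * \<alpha> u) = c * t \<beta> \<alpha>"
    if "\<alpha> \<in> dual_fibre A x" for c \<alpha>
    using assms(1,4) that unfolding tensor_fibre_def by blast+
  show "t (\<lambda>u. a * \<alpha> u + a' * \<alpha>' u) \<beta> = a * t \<alpha> \<beta> + a' * t \<alpha>' \<beta>"
    "t \<beta> (\<lambda>u. a * \<alpha> u + a' * \<alpha>' u) = a * t \<beta> \<alpha> + a' * t \<beta> \<alpha>'"
    using assms(2,3) by (simp_all add: add dual_fibre_scale scale)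
qed

lemma tensor_fibre_eq_0:
  "t \<in> tensor_fibre A x \<Longrightarrow> \<alpha> \<notin> dual_fibre A x \<or> \<beta> \<notin> dual_fibre A x \<Longrightarrow> t \<alpha> \<beta> = 0"
  unfolding tensor_fibre_def by blast

context
  fixes A :: "('b, 'e) bundle_data" and x f
  assumes A: "hermitian_bundle_rank2 A" and x: "x \<in> topspace (base A)"
    and f: "isometric_frame A x f"
begin

lemma coord_functional_in_dual: "coord_functional A x f i \<in> dual_fibre A x"
proof -
  have "vplus A u v = f (frame_coords A f u + frame_coords A f v)"
    "vscale A c u = f (c *s frame_coords A f u)" if "u \<in> fibre A x" "v \<in> fibre A x" for c u v
    using frame_coords_left_inverse [OF A x f] that isometric_frameD(3,4) [OF f] by metis+
  then show ?thesis
    using isometric_frameD(1) [OF f] frame_coords_frame [OF f]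
    unfolding dual_fibre_def coord_functional_def by auto
qed

lemma dual_fibre_expand:
  assumes "\<alpha> \<in> dual_fibre A x"
  shows "\<alpha> = (\<lambda>u. \<alpha> (f (axis 1 1)) * coord_functional A x f 1 u
                   + \<alpha> (f (axis 2 1)) * coord_functional A x f 2 u)"
proof
  fix u
  show "\<alpha> u = \<alpha> (f (axis 1 1)) * coord_functional A x f 1 u + \<alpha> (f (axis 2 1)) * coord_functional A x f 2 u"
  proof (cases "u \<in> fibre A x")
    case True
    then show ?thesis
      using dual_fibre_frame [OF f assms, of "frame_coords A f u"] frame_coords_left_inverse [OF A x f True]
      by (simp add: coord_functional_def mult.commute)
  next
    case False
    then show ?thesis using assms by (simp add: coord_functional_def dual_fibre_def)
  qed
qed

lemma tensor_fibre_expand: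
  assumes t: "t \<in> tensor_fibre A x" and \<alpha>: "\<alpha> \<in> dual_fibre A x" and \<beta>: "\<beta> \<in> dual_fibre A x"
  shows "t \<alpha> \<beta> = (\<Sum>i\<in>UNIV. \<Sum>j\<in>UNIV. tensor_matrix A x f t $ i $ j * (\<alpha> (f (axis i 1)) * \<beta> (f (axis j 1))))"
proof -
  define \<delta> where "\<delta> = coord_functional A x f"
  have \<delta>: "\<delta> i \<in> dual_fibre A x" for i
    using coord_functional_in_dual by (simp add: \<delta>_def)
  have "t \<alpha> \<beta> = t (\<lambda>u. \<alpha> (f (axis 1 1)) * \<delta> 1 u + \<alpha> (f (axis 2 1)) * \<delta> 2 u) \<beta>"
    using dual_fibre_expand [OF \<alpha>] by (simp add: \<delta>_def)
  also have "\<dots> = \<alpha> (f (axis 1 1)) * t (\<delta> 1) \<beta> + \<alpha> (f (axis 2 1)) * t (\<delta> 2) \<beta>"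
    by (rule tensor_fibre_lincomb [OF t \<delta> \<delta> \<beta>])
  finally have *: "t \<alpha> \<beta> = \<alpha> (f (axis 1 1)) * t (\<delta> 1) \<beta> + \<alpha> (f (axis 2 1)) * t (\<delta> 2) \<beta>" .
  have "t (\<delta> i) \<beta> = \<beta> (f (axis 1 1)) * t (\<delta> i) (\<delta> 1) + \<beta> (f (axis 2 1)) * t (\<delta> i) (\<delta> 2)" for i
  proof -
    have "t (\<delta> i) \<beta> = t (\<delta> i) (\<lambda>u. \<beta> (f (axis 1 1)) * \<delta> 1 u + \<beta> (f (axis 2 1)) * \<delta> 2 u)"
      using dual_fibre_expand [OF \<beta>] by (simp add: \<delta>_def)
    then show ?thesis by (simp add: tensor_fibre_lincomb [OF t \<delta> \<delta> \<delta>])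
  qed
  then show ?thesis
    unfolding * by (simp add: sum_2 tensor_matrix_def algebra_simps flip: \<delta>_def)
qed

text \<open>The second slot may use another frame \<open>f'\<close>, since a maximally entangled
  tensor is diagonal in a pair of different bases. As \<open>f'\<close> is arbitrary here, its
  coordinate functional might fail to be linear, whence the case distinction.\<close>

lemma tensor_coord_functional:
  assumes "v \<in> fibre A x" "w \<in> fibre A x"
  shows "tensor A x v w (coord_functional A x f i) (coord_functional A x f' j)
    = (if coord_functional A x f' j \<in> dual_fibre A x
       then frame_coords A f v $ i * frame_coords A f' w $ j else 0)"
  using assms coord_functional_in_dual by (simp add: tensor_def coord_functional_def)

end

text \<open>Both slots are complex linear and change by \<open>K\<close>, so the matrix changes by a
  congruence with the plain transpose, not the adjoint.\<close>

lemma tensor_matrix_change: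
  assumes A: "hermitian_bundle_rank2 A" and x: "x \<in> topspace (base A)"
    and f: "isometric_frame A x f" and f': "isometric_frame A x f'"
    and t: "t \<in> tensor_fibre A x" and K: "\<And>u. f' u = f (K *v u)"
  shows "tensor_matrix A x f t = K ** tensor_matrix A x f' t ** transpose K"
proof -
  have K': "coord_functional A x f i (f' (axis j 1)) = K $ i $ j" for i j
  proof -
    have "coord_functional A x f i (f' (axis j 1)) = (K *v axis j 1) $ i"
      using isometric_frameD(1) [OF f] by (simp add: coord_functional_def K frame_coords_frame [OF f])
    then show ?thesis
      using exhaust_2 [of j] by (auto simp: matrix_vec_2 axis_def)
  qed
  have "tensor_matrix A x f t $ i $ j = (\<Sum>k\<in>UNIV. \<Sum>l\<in>UNIV. tensor_matrix A x f' t $ k $ l * (K$i$k * K$j$l))" for i j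
    using tensor_fibre_expand [OF A x f' t coord_functional_in_dual [OF A x f] coord_functional_in_dual [OF A x f], of i j]
    by (simp only: K') (simp add: tensor_matrix_def)
  then show ?thesis
    by (simp add: mat2_eq_iff matrix_mul_2 sum_2 transpose_def algebra_simps)
qed

lemma tensor_fibre_eqI:
  assumes A: "hermitian_bundle_rank2 A" "x \<in> topspace (base A)" "isometric_frame A x f"
    and t: "t \<in> tensor_fibre A x" and t': "t' \<in> tensor_fibre A x"
    and eq: "tensor_matrix A x f t = tensor_matrix A x f t'"
  shows "t = t'"
proof (intro ext)
  fix \<alpha> \<beta>
  show "t \<alpha> \<beta> = t' \<alpha> \<beta>"
  proof (cases "\<alpha> \<in> dual_fibre A x \<and> \<beta> \<in> dual_fibre A x")
    case True
    then show ?thesis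
      using tensor_fibre_expand [OF A t, of \<alpha> \<beta>] tensor_fibre_expand [OF A t', of \<alpha> \<beta>] eq by simp
  next
    case False
    then show ?thesis
      using tensor_fibre_eq_0 [OF t, of \<alpha> \<beta>] tensor_fibre_eq_0 [OF t', of \<alpha> \<beta>] by auto
  qed
qed

lemma tensor_matrix_tensor:
  assumes "hermitian_bundle_rank2 A" "x \<in> topspace (base A)" "isometric_frame A x f"
    and "v \<in> fibre A x" "w \<in> fibre A x"
  shows "tensor_matrix A x f (tensor A x v w) = (\<chi> i j. frame_coords A f v $ i * frame_coords A f w $ j)"
  using tensor_coord_functional [OF assms, of _ f] coord_functional_in_dual [OF assms(1-3)]
  by (simp add: tensor_matrix_def)

lemma tensor_fibre_combination:
  assumes "t \<in> tensor_fibre A x" "t' \<in> tensor_fibre A x"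
  shows "(\<lambda>\<alpha> \<beta>. a * t \<alpha> \<beta> + b * t' \<alpha> \<beta>) \<in> tensor_fibre A x"
  using assms unfolding tensor_fibre_def by (auto simp: algebra_simps)

section \<open>Simple and maximally entangled tensors\<close>

lemma orthonormal_basis_frame:
  assumes A: "hermitian_bundle_rank2 A" and x: "x \<in> topspace (base A)"
    and f: "isometric_frame A x f" and e: "orthonormal_basis A x e0 e1"
  obtains g where "isometric_frame A x g" "g (axis 1 1) = e0" "g (axis 2 1) = e1"
proof -
  define a b where "a = frame_coords A f e0" and "b = frame_coords A f e1"
  have ab: "e0 = f a" "e1 = f b"
    using e frame_coords_left_inverse [OF A x f] by (auto simp: orthonormal_basis_def a_def b_def)
  define K :: "complex^2^2" where "K = (\<chi> i j. if j = 1 then a $ i else b $ i)"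
  have "cinner2 a a = 1" "cinner2 b b = 1" "cinner2 a b = 0"
    using e isometric_frameD(5) [OF f] by (auto simp: orthonormal_basis_def ab)
  moreover have "cinner2 b a = cnj (cinner2 a b)"
    by (simp add: cinner2_expand mult.commute)
  ultimately have "adjoint_mat K ** K = mat 1"
    by (simp add: mat2_eq_iff matrix_mul_2 K_def mat_nth cinner2_expand)
  then have "isometric_frame A x (\<lambda>u. f (K *v u))"
    by (rule isometric_frame_change [OF f])
  moreover have "K *v axis 1 1 = a" "K *v axis 2 1 = b"
    by (simp_all add: vec2_eq_iff matrix_vec_2 K_def axis_def)
  ultimately show ?thesis
    using that ab by simp
qed

lemma orthonormal_basis_of_frame:
  assumes f: "isometric_frame A x f" and "cinner2 u u = 1" "cinner2 v v = 1" "cinner2 u v = 0"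
  shows "orthonormal_basis A x (f u) (f v)"
  using assms(2-4) isometric_frameD(1,5) [OF f] by (simp add: orthonormal_basis_def)

text \<open>Use the frame of \<open>e0, e1\<close> in the first slot and that of
  \<open>f0, f1\<close> in the second. There a maximally entangled tensor has matrix
  \<open>c\<close> times the identity, while the matrix of a simple tensor has determinant
  0.\<close>

lemma maximally_entangled_not_simple:
  assumes A: "hermitian_bundle_rank2 A" and x: "x \<in> topspace (base A)"
    and f: "isometric_frame A x f" and t: "maximally_entangled A x t"
  shows "\<not> simple_tensor A x t"
proof
  assume "simple_tensor A x t"
  then obtain v w where vw: "v \<in> fibre A x" "w \<in> fibre A x" "t = tensor A x v w"
    by (auto simp: simple_tensor_def)
  obtain e0 e1 f0 f1 c where e: "orthonormal_basis A x e0 e1" and f': "orthonormal_basis A x f0 f1"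
    and "c \<noteq> 0" and t: "t = (\<lambda>\<alpha> \<beta>. c * (tensor A x e0 f0 \<alpha> \<beta> + tensor A x e1 f1 \<alpha> \<beta>))"
    using t unfolding maximally_entangled_def by blast
  obtain g where g: "isometric_frame A x g" "g (axis 1 1) = e0" "g (axis 2 1) = e1"
    using orthonormal_basis_frame [OF A x f e] .
  obtain h where h: "isometric_frame A x h" "h (axis 1 1) = f0" "h (axis 2 1) = f1"
    using orthonormal_basis_frame [OF A x f f'] .
  have mem: "e0 \<in> fibre A x" "e1 \<in> fibre A x" "f0 \<in> fibre A x" "f1 \<in> fibre A x"
    using e f' by (auto simp: orthonormal_basis_def)
  define T where "T i j = t (coord_functional A x g i) (coord_functional A x h j)" for i j
  have "T i j = frame_coords A g v $ i * frame_coords A h w $ j" for i j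
    by (simp add: T_def vw tensor_coord_functional [OF A x g(1)] coord_functional_in_dual [OF A x h(1)])
  then have "T 1 1 * T 2 2 = T 1 2 * T 2 1"
    by simp
  moreover have coords: "frame_coords A g e0 = axis 1 1" "frame_coords A g e1 = axis 2 1"
    "frame_coords A h f0 = axis 1 1" "frame_coords A h f1 = axis 2 1"
    using frame_coords_frame [OF g(1)] frame_coords_frame [OF h(1)] g(2,3) h(2,3) by metis+
  have "T 1 1 = c" "T 2 2 = c" "T 1 2 = 0"
    by (simp_all add: T_def t tensor_coord_functional [OF A x g(1)] mem coords
        coord_functional_in_dual [OF A x h(1)] axis_def)
  ultimately show False using \<open>c \<noteq> 0\<close> by simp
qed

text \<open>The scalar \<open>c\<close> is a positive real \<open>r\<close>, so \<open>M\<close> is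
  \<open>sqrt r\<close> times a unitary matrix. Read column by column, \<open>M\<close> exhibits
  \<open>t\<close> as \<open>sqrt r\<close> times the sum over \<open>j\<close> of
  \<open>f (col j)\<close> tensored with \<open>f (axis j 1)\<close>, and both families are
  orthonormal.\<close>

lemma maximally_entangledI:
  assumes A: "hermitian_bundle_rank2 A" and x: "x \<in> topspace (base A)"
    and f: "isometric_frame A x f" and t: "t \<in> tensor_fibre A x" "t \<noteq> (\<lambda>\<alpha> \<beta>. 0)"
    and c: "tensor_matrix A x f t ** adjoint_mat (tensor_matrix A x f t) = mat c"
  shows "maximally_entangled A x t"
proof -
  define M where "M = tensor_matrix A x f t"
  define r where "r = (cmod (M$1$1))\<^sup>2 + (cmod (M$1$2))\<^sup>2"
  have MM: "(M ** adjoint_mat M) $ i $ j = mat c $ i $ j" for i j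
    using c by (simp add: M_def)
  have "c = complex_of_real r"
    using MM [of 1 1] unfolding r_def of_real_add complex_norm_square by (simp add: matrix_mul_2 mat_nth)
  \<comment> \<open>The diagonal entries of the product are the squared lengths of the rows of
    \<open>M\<close>; if they were 0, the tensor would vanish.\<close>
  have "r \<noteq> 0"
  proof
    assume "r = 0"
    then have "c = 0" by (simp add: \<open>c = complex_of_real r\<close>)
    have *: "M $ i $ 1 = 0 \<and> M $ i $ 2 = 0" for i
    proof -
      have "complex_of_real ((cmod (M$i$1))\<^sup>2 + (cmod (M$i$2))\<^sup>2) = 0"
        using MM [of i i] \<open>c = 0\<close> unfolding of_real_add complex_norm_square
        by (simp add: matrix_mul_2 mat_nth)
      then show ?thesis
        by (simp only: of_real_eq_0_iff) (simp add: add_nonneg_eq_0_iff)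
    qed
    have zero: "(\<lambda>\<alpha> \<beta>. 0) \<in> tensor_fibre A x"
      by (simp add: tensor_fibre_def)
    have "tensor_matrix A x f t = tensor_matrix A x f (\<lambda>\<alpha> \<beta>. 0)"
      using * unfolding M_def [symmetric] by (simp add: mat2_eq_iff tensor_matrix_def)
    then show False
      using tensor_fibre_eqI [OF A x f t(1) zero] t(2) by blast
  qed
  then have "r > 0" by (metis r_def add_nonneg_nonneg less_eq_real_def zero_le_power2)
  have "adjoint_mat M ** M = mat c"
    using scalar_mul_adjoint_swap c \<open>r \<noteq> 0\<close> unfolding M_def by (simp add: \<open>c = complex_of_real r\<close>)
  then have MM': "(adjoint_mat M ** M) $ i $ j = mat c $ i $ j" for i j
    by simp
  define q where "q = complex_of_real (sqrt r)"
  have q: "q * q = c" "cnj q = q" "q \<noteq> 0"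
    using \<open>r > 0\<close> by (simp_all add: q_def \<open>c = complex_of_real r\<close> flip: of_real_mult)
  define col where "col j = (\<chi> i. M $ i $ j / q)" for j
  have inner: "cinner2 (col i) (col j) = (if i = j then 1 else 0)" for i j
  proof -
    have "cinner2 (col i) (col j) = (adjoint_mat M ** M) $ i $ j / (q * q)"
      by (simp add: cinner2_expand col_def q(2) matrix_mul_2 add_divide_distrib)
    then show ?thesis
      unfolding MM' using q(1,3) by (auto simp: mat_nth)
  qed
  define f' where "f' = (\<lambda>j::2. f (axis j 1))"
  define t' where "t' = (\<lambda>\<alpha> \<beta>. q * (tensor A x (f (col 1)) (f' 1) \<alpha> \<beta> + tensor A x (f (col 2)) (f' 2) \<alpha> \<beta>))"
  have "t' = (\<lambda>\<alpha> \<beta>. q * tensor A x (f (col 1)) (f' 1) \<alpha> \<beta> + q * tensor A x (f (col 2)) (f' 2) \<alpha> \<beta>)"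
    by (simp add: t'_def algebra_simps)
  then have "t' \<in> tensor_fibre A x"
    by (simp only: tensor_fibre_combination [OF tensor_in_tensor_fibre tensor_in_tensor_fibre])
  moreover have "tensor_matrix A x f t' $ i $ j = M $ i $ j" for i j
  proof -
    have "tensor_matrix A x f t' $ i $ j
        = q * (tensor_matrix A x f (tensor A x (f (col 1)) (f' 1)) $ i $ j
             + tensor_matrix A x f (tensor A x (f (col 2)) (f' 2)) $ i $ j)"
      by (simp add: tensor_matrix_def t'_def)
    also have "\<dots> = M $ i $ j"
      using exhaust_2 [of j] q(3) isometric_frameD(1) [OF f]
      by (auto simp: tensor_matrix_tensor [OF A x f] f'_def frame_coords_frame [OF f] col_def axis_def)
    finally show ?thesis .
  qed
  then have "tensor_matrix A x f t = tensor_matrix A x f t'"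
    by (simp add: M_def vec_eq_iff)
  ultimately have "t = t'"
    using tensor_fibre_eqI [OF A x f t(1)] by blast
  moreover have "orthonormal_basis A x (f (col 1)) (f (col 2))" "orthonormal_basis A x (f' 1) (f' 2)"
    unfolding f'_def 
    by (intro orthonormal_basis_of_frame [OF f]; simp add: inner)
      (intro orthonormal_basis_of_frame [OF f]; simp add: cinner2_axis; simp add: axis_def)
  ultimately show ?thesis
    unfolding maximally_entangled_def t'_def using q(3) by blast
qed

text \<open>Continuity of \<open>\<psi>\<close> is given in some local trivialization with
  coefficients \<open>m\<close>. In the frame \<open>F\<close> the matrix is \<open>R m R^T\<close>,
  where \<open>R\<close> is the continuous transition matrix.\<close>

lemma continuous_map_tensor_matrix:
  assumes A: "hermitian_bundle_rank2 A" and p: "continuous_map X (base A) p"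
    and F: "frame_along A X p F" and \<psi>: "continuous_tensor_section A \<psi>"
  shows "continuous_map X euclidean (\<lambda>x. tensor_matrix A (p x) (F x) (\<psi> (p x)))"
proof (rule continuous_map_locally)
  fix x assume x: "x \<in> topspace X"
  then have px: "p x \<in> topspace (base A)"
    by (rule continuous_map_topspace [OF p])
  obtain U \<phi> m where U: "openin (base A) U" "p x \<in> U" and \<phi>: "trivialization A U \<phi>"
    and m: "\<forall>i j. continuous_map (subtopology (base A) U) euclidean (m i j)"
    and \<psi>m: "\<forall>y\<in>U. \<psi> y = (\<lambda>\<alpha> \<beta>. \<Sum>i\<in>(UNIV :: 2 set). \<Sum>j\<in>(UNIV :: 2 set).
            (m i j y :: complex) * tensor A y (\<phi> (y, axis i 1)) (\<phi> (y, axis j 1)) \<alpha> \<beta>)"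
    using bspec [OF conjunct2 [OF \<psi> [unfolded continuous_tensor_section_def]] px]
    by (elim exE conjE) (rule that)
  define T where "T = {x \<in> topspace X. p x \<in> U}"
  define R where "R y = frame_ratio A (F y) (\<lambda>u. \<phi> (p y, u))" for y
  have T: "openin X T"
    unfolding T_def using openin_continuous_map_preimage [OF p U(1)] .
  have pT: "continuous_map (subtopology X T) (subtopology (base A) U) p"
    using p by (auto simp: T_def continuous_map_in_subtopology continuous_map_from_subtopology)
  have FT: "frame_along A (subtopology X T) p F"
    using frame_along_compose [OF F continuous_map_id_subt] by (simp add: id_def)
  have \<phi>T: "frame_along A (subtopology X T) p (\<lambda>y u. \<phi> (p y, u))"
    using frame_along_compose [OF trivialization_frame_along [OF \<phi>] pT] by simp
  have R: "continuous_map (subtopology X T) euclidean R"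
    unfolding R_def using pT by (intro continuous_map_frame_ratio [OF A _ FT \<phi>T])
      (simp add: continuous_map_in_subtopology)
  have entry: "tensor_matrix A (p y) (F y) (\<psi> (p y)) $ i $ j
      = (\<Sum>k\<in>UNIV. \<Sum>l\<in>UNIV. m k l (p y) * (R y $ i $ k * R y $ j $ l))" if y: "y \<in> T" for y i j
  proof -
    have py: "p y \<in> U" "p y \<in> topspace (base A)"
      using y continuous_map_topspace [OF p] by (auto simp: T_def)
    have Fy: "isometric_frame A (p y) (F y)"
      using frame_alongD [OF F] y by (auto simp: T_def)
    have mem: "\<phi> (p y, u) \<in> fibre A (p y)" for u
      using isometric_frameD(1) [OF trivialization_isometric_frame [OF \<phi> py(1)]] .
    have "tensor A (p y) (\<phi> (p y, axis k 1)) (\<phi> (p y, axis l 1))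
          (coord_functional A (p y) (F y) i) (coord_functional A (p y) (F y) j) = R y $ i $ k * R y $ j $ l" for k l
      using coord_functional_in_dual [OF A py(2) Fy]
      by (simp add: tensor_coord_functional [OF A py(2) Fy] mem R_def frame_ratio_def frame_coords_def)
    then show ?thesis
      by (simp add: tensor_matrix_def bspec [OF \<psi>m py(1)])
  qed
  have "continuous_map (subtopology X T) euclidean
      (\<lambda>y. \<chi> i j. \<Sum>k\<in>UNIV. \<Sum>l\<in>UNIV. m k l (p y) * (R y $ i $ k * R y $ j $ l))"
    by (intro continuous_map_vec_lambda continuous_map_sum continuous_map_times continuous_map_vec_nth R
        continuous_map_compose [OF pT m [rule_format], unfolded o_def]) auto
  then have "continuous_map (subtopology X T) euclidean (\<lambda>y. tensor_matrix A (p y) (F y) (\<psi> (p y)))"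
    by (rule continuous_map_eq) (auto simp: vec_eq_iff entry)
  then show "\<exists>T. openin X T \<and> x \<in> T \<and>
      continuous_map (subtopology X T) euclidean (\<lambda>x. tensor_matrix A (p x) (F x) (\<psi> (p x)))"
    using T x U(2) unfolding T_def by blast
qed

section \<open>The determinant line\<close>

lemma frame_ratioI:
  assumes "isometric_frame A x f" "\<And>u. g u = f (K *v u)"
  shows "frame_ratio A f g = K"
proof -
  have "frame_ratio A f g $ i $ j = (K *v axis j 1) $ i" for i j
    by (simp add: frame_ratio_def assms(2) isometric_frameD(5) [OF assms(1)] cinner2_axis)
  moreover have "(K *v axis j 1) $ i = K $ i $ j" for i j
    using exhaust_2 [of j] by (auto simp: matrix_vec_2 axis_def)
  ultimately show ?thesis by (simp add: vec_eq_iff)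
qed

lemma frame_ratio_trans:
  assumes A: "hermitian_bundle_rank2 A" "x \<in> topspace (base A)"
    and f: "isometric_frame A x f" and g: "isometric_frame A x g" and h: "isometric_frame A x h"
  shows "frame_ratio A f h = frame_ratio A f g ** frame_ratio A g h"
proof (rule frame_ratioI [OF f])
  show "h u = f (frame_ratio A f g ** frame_ratio A g h *v u)" for u
    using frame_ratio [OF A f g] frame_ratio [OF A g h] by (simp flip: matrix_vector_mul_assoc)
qed

definition wedge :: "('b, 'e) bundle_data \<Rightarrow> 'b \<Rightarrow> (complex^2 \<Rightarrow> 'e) \<Rightarrow> 'e tensor2" where
  "wedge A x f = (\<lambda>\<alpha> \<beta>. tensor A x (f (axis 1 1)) (f (axis 2 1)) \<alpha> \<beta> - tensor A x (f (axis 2 1)) (f (axis 1 1)) \<alpha> \<beta>)"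

lemma wedge_in_skew_fibre: "wedge A x f \<in> skew_fibre A x"
proof -
  have "wedge A x f = (\<lambda>\<alpha> \<beta>. 1 * tensor A x (f (axis 1 1)) (f (axis 2 1)) \<alpha> \<beta>
      + (-1) * tensor A x (f (axis 2 1)) (f (axis 1 1)) \<alpha> \<beta>)"
    by (simp add: wedge_def)
  then have "wedge A x f \<in> tensor_fibre A x"
    by (simp only: tensor_fibre_combination [OF tensor_in_tensor_fibre tensor_in_tensor_fibre])
  then show ?thesis
    by (simp add: skew_fibre_def wedge_def tensor_def mult.commute)
qed

text \<open>The skew part is the second exterior power, on which \<open>K\<close> acts by its
  determinant.\<close>

lemma wedge_change:
  assumes f: "isometric_frame A x f" and K: "\<And>u. f' u = f (K *v u)"
  shows "wedge A x f' \<alpha> \<beta> = det K * wedge A x f \<alpha> \<beta>"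
proof -
  have K': "K *v axis j 1 = (\<chi> i. K $ i $ j)" for j
    using exhaust_2 [of j] by (auto simp: vec2_eq_iff matrix_vec_2 axis_def)
  show ?thesis
    using dual_fibre_frame [OF f, of \<alpha> "\<chi> i. K $ i $ 1"] dual_fibre_frame [OF f, of \<alpha> "\<chi> i. K $ i $ 2"]
      dual_fibre_frame [OF f, of \<beta> "\<chi> i. K $ i $ 1"] dual_fibre_frame [OF f, of \<beta> "\<chi> i. K $ i $ 2"]
    by (cases "\<alpha> \<in> dual_fibre A x \<and> \<beta> \<in> dual_fibre A x")
      (auto simp add: wedge_def tensor_def K K' det_2 algebra_simps)
qed

lemma wedge_singlet:
  assumes "isometric_frame A x f"
  shows "singlet A x (wedge A x f)"
proof -
  have "orthonormal_basis A x (f (axis 1 1)) (f (axis 2 1))"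
    by (intro orthonormal_basis_of_frame [OF assms]; simp add: cinner2_axis; simp add: axis_def)
  then show ?thesis
    unfolding singlet_def wedge_def by (intro exI conjI) (assumption, rule one_neq_zero, simp)
qed

lemma wedge_nonzero:
  assumes "hermitian_bundle_rank2 A" "x \<in> topspace (base A)" "isometric_frame A x f"
  shows "wedge A x f \<noteq> (\<lambda>\<alpha> \<beta>. 0)"
proof -
  have "wedge A x f (coord_functional A x f 1) (coord_functional A x f 2) = 1"
    using isometric_frameD(1) [OF assms(3)] coord_functional_in_dual [OF assms]
    by (simp add: wedge_def tensor_coord_functional [OF assms] frame_coords_frame [OF assms(3)] axis_def)
  then show ?thesis by (metis zero_neq_one)
qed

text \<open>The two frames need not agree on the overlap, but their wedges do because the transition
  has determinant 1. In a local trivialization the wedge is a scalar multiple of the local one; that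
  scalar is continuous on each closed piece and is pasted together.\<close>

lemma continuous_wedge_section:
  assumes A: "hermitian_bundle_rank2 A"
    and ST: "closedin (base A) S" "closedin (base A) T" "topspace (base A) \<subseteq> S \<union> T"
    and F: "frame_along A (subtopology (base A) S) (\<lambda>x. x) F"
    and F': "frame_along A (subtopology (base A) T) (\<lambda>x. x) F'"
    and det: "\<And>x. x \<in> S \<inter> T \<Longrightarrow> det (frame_ratio A (F x) (F' x)) = 1"
  shows "continuous_tensor_section A (\<lambda>x. wedge A x (if x \<in> S then F x else F' x))"
  unfolding continuous_tensor_section_def
proof (intro conjI ballI)
  fix x assume x: "x \<in> topspace (base A)"
  show "wedge A x (if x \<in> S then F x else F' x) \<in> tensor_fibre A x"
    using wedge_in_skew_fibre [of A x] unfolding skew_fibre_def by blast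
  obtain U \<phi> where U: "openin (base A) U" "x \<in> U" and \<phi>: "trivialization A U \<phi>"
    using A x unfolding hermitian_bundle_rank2_def by blast
  let ?X = "subtopology (base A) U"
  define \<Phi> where "\<Phi> y u = \<phi> (y, u)" for y u
  define d where "d i y = det (frame_ratio A (\<Phi> y) (if i then F y else F' y))" for i y
  have UB: "U \<subseteq> topspace (base A)"
    using U(1) openin_subset by blast
  have frames: "isometric_frame A y (\<Phi> y)" "y \<in> S \<Longrightarrow> isometric_frame A y (F y)"
    "y \<in> T \<Longrightarrow> isometric_frame A y (F' y)" if "y \<in> U" for y
    using trivialization_isometric_frame [OF \<phi> that] frame_alongD [OF F] frame_alongD [OF F'] that UB
    by (auto simp: \<Phi>_def [abs_def])
  have d_eq: "d True y = d False y" if "y \<in> U \<inter> S \<inter> T" for y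
  proof -
    have "frame_ratio A (\<Phi> y) (F' y) = frame_ratio A (\<Phi> y) (F y) ** frame_ratio A (F y) (F' y)"
      using that UB frames [of y] by (intro frame_ratio_trans [OF A]) auto
    then show ?thesis
      using det [of y] that by (simp add: d_def det_mul)
  qed
  have d_cont: "continuous_map (subtopology (base A) (U \<inter> R)) euclidean (\<lambda>y. det (frame_ratio A (\<Phi> y) (E y)))"
    if E: "frame_along A (subtopology (base A) R) (\<lambda>x. x) E" for R E
  proof -
    let ?Y = "subtopology (base A) (U \<inter> R)"
    have sub: "continuous_map ?Y (subtopology (base A) V) (\<lambda>x. x)" if "U \<inter> R \<subseteq> V" for V
      using that by (auto simp: continuous_map_in_subtopology intro: continuous_map_from_subtopology)
    have "continuous_map ?Y euclidean (\<lambda>y. frame_ratio A (\<Phi> y) (E y))"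
    proof (rule continuous_map_frame_ratio [OF A, where p = "\<lambda>y. y"])
      show "continuous_map ?Y (base A) (\<lambda>y. y)"
        by (simp add: continuous_map_from_subtopology)
      show "frame_along A ?Y (\<lambda>y. y) \<Phi>"
        using frame_along_compose [OF trivialization_frame_along [OF \<phi>] sub] by (simp add: \<Phi>_def [abs_def])
      show "frame_along A ?Y (\<lambda>y. y) E"
        using frame_along_compose [OF E sub] by simp
    qed
    then show ?thesis
      unfolding det_2 by (intro continuous_intros)
  qed
  define m where "m y = d (y \<in> S) y" for y
  have "continuous_map ?X euclidean m"
  proof (rule pasting_lemma_closed [where I = "{True, False}" and T = "\<lambda>i. U \<inter> (if i then S else T)" and f = d])
    show "closedin ?X (U \<inter> (if i then S else T))" for i
      using ST by (auto simp: closedin_subtopology_Int_closed)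
    show "continuous_map (subtopology ?X (U \<inter> (if i then S else T))) euclidean (d i)" for i
      using d_cont [OF F] d_cont [OF F'] by (cases i) (simp_all add: subtopology_subtopology d_def [abs_def])
    show "d i y = d j y" if "y \<in> topspace ?X \<inter> (U \<inter> (if i then S else T)) \<inter> (U \<inter> (if j then S else T))" for i j y
      using that d_eq [of y] by (cases i; cases j) auto
    show "\<exists>j. j \<in> {True, False} \<and> y \<in> U \<inter> (if j then S else T) \<and> m y = d j y" if "y \<in> topspace ?X" for y
      using that ST(3) UB by (intro exI [of _ "y \<in> S"]) (auto simp: m_def)
  qed simp
  \<comment> \<open>These are the entries 0, \<open>m\<close>, \<open>-m\<close>, 0 of the
    skew-symmetric coefficient matrix of \<open>m y\<close> times the wedge of the local
    frame.\<close>
  then have "continuous_map ?X euclidean (\<lambda>y. (if i = j then 0 else if i = 1 then 1 else -1) * m y)" for i j :: 2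
    by (intro continuous_map_times) auto
  moreover have "wedge A y (if y \<in> S then F y else F' y) = (\<lambda>\<alpha> \<beta>. \<Sum>i\<in>UNIV. \<Sum>j\<in>UNIV.
      (if i = j then 0 else if i = (1::2) then 1 else -1) * m y * tensor A y (\<phi> (y, axis i 1)) (\<phi> (y, axis j 1)) \<alpha> \<beta>)"
    if "y \<in> U" for y
  proof (intro ext)
    fix \<alpha> \<beta>
    have E: "isometric_frame A y (if y \<in> S then F y else F' y)"
      using frames [OF that] that ST(3) UB by auto
    have "wedge A y (if y \<in> S then F y else F' y) \<alpha> \<beta> = m y * wedge A y (\<Phi> y) \<alpha> \<beta>"
      unfolding m_def d_def
      using wedge_change [OF frames(1) [OF that] frame_ratio [OF A _ frames(1) [OF that] E]] that UB by auto
    then show "wedge A y (if y \<in> S then F y else F' y) \<alpha> \<beta> = (\<Sum>i\<in>UNIV. \<Sum>j\<in>UNIV.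
      (if i = j then 0 else if i = (1::2) then 1 else -1) * m y * tensor A y (\<phi> (y, axis i 1)) (\<phi> (y, axis j 1)) \<alpha> \<beta>)"
      by (simp add: sum_2 wedge_def \<Phi>_def algebra_simps)
  qed
  ultimately show "\<exists>U \<phi> m. openin (base A) U \<and> x \<in> U \<and> trivialization A U \<phi> \<and>
        (\<forall>i j. continuous_map (subtopology (base A) U) euclidean (m i j)) \<and>
        (\<forall>y\<in>U. wedge A y (if y \<in> S then F y else F' y) = (\<lambda>\<alpha> \<beta>. \<Sum>i\<in>(UNIV :: 2 set). \<Sum>j\<in>(UNIV :: 2 set).
            (m i j y :: complex) * tensor A y (\<phi> (y, axis i 1)) (\<phi> (y, axis j 1)) \<alpha> \<beta>))"
    using U \<phi>
    by (intro exI [of _ U] exI [of _ \<phi>]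
        exI [of _ "\<lambda>i j y. (if i = j then 0 else if i = (1::2) then 1 else -1) * m y"]) auto
qed

section \<open>Clutching over the 4-sphere\<close>

text \<open>Frames over the two hemispheres, both parametrized by the unit ball, and the coordinates \<open>s\<close> of
  a section over the lower one. The last clause is what is used of \<open>c\<^sub>2(A) \<noteq> 0\<close>.\<close>

definition clutching_data ::
    "(nat \<Rightarrow> real, 'e) bundle_data \<Rightarrow> (complex^2 \<Rightarrow> complex^2 \<Rightarrow> 'e) \<Rightarrow> (complex^2 \<Rightarrow> complex^2 \<Rightarrow> 'e)
      \<Rightarrow> (complex^2 \<Rightarrow> complex^2) \<Rightarrow> bool" where
  "clutching_data A F F' s \<longleftrightarrow>
     frame_along A (top_of_set (cball 0 1)) (hemisphere_point 1) F \<and>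
     frame_along A (top_of_set (cball 0 1)) (hemisphere_point (-1)) F' \<and>
     (\<forall>z\<in>sphere 0 1. det (frame_ratio A (F z) (F' z)) = 1) \<and>
     continuous_on (cball 0 1) s \<and> (\<forall>z\<in>cball 0 1. s z \<noteq> 0) \<and>
     (\<forall>a. \<not> homotopic_with_canon (\<lambda>_. True) (sphere 0 1) (-{0}) (\<lambda>z. frame_ratio A (F z) (F' z) *v s z) (\<lambda>_. a))"

lemma hemisphere_point_upper:
  "z \<in> cball 0 1 \<Longrightarrow> hemisphere_point 1 z \<in> upper_hemisphere"
  using hemisphere_point_in_nsphere [of z 1] hemisphere_point_4_sign [of z] by (simp add: upper_hemisphere_def)

lemma hemisphere_point_lower:
  "z \<in> cball 0 1 \<Longrightarrow> hemisphere_point (-1) z \<in> lower_hemisphere"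
  using hemisphere_point_in_nsphere [of z "-1"] hemisphere_point_4_sign [of z] by (simp add: lower_hemisphere_def)

lemma cmod_det_isometry:
  assumes "adjoint_mat G ** G = (mat 1 :: complex^2^2)"
  shows "cmod (det G) = 1"
proof -
  have "det (adjoint_mat G) = cnj (det G)"
    by (simp add: det_2 mult.commute)
  then have "cnj (det G) * det G = 1"
    using assms by (metis det_mul det_I)
  then have "(cmod (det G))\<^sup>2 = 1"
    by (metis complex_norm_square mult.commute of_real_eq_1_iff)
  then show ?thesis by (simp add: abs_square_eq_1)
qed

text \<open>The determinant of the transition function has a logarithm, because \<open>S\<^sup>3\<close> is simply connected,
  and its extension to the ball corrects the first basis vector.\<close>

lemma unimodular_frame:
  assumes A: "hermitian_bundle_rank2 A"
    and q: "continuous_map (top_of_set (sphere 0 1)) (base A) q"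
    and F: "frame_along A (top_of_set (sphere 0 1)) q F"
    and p: "\<And>z. z \<in> sphere 0 1 \<Longrightarrow> p z = q z"
    and F0: "frame_along A (top_of_set (cball (0::complex^2) 1)) p F0"
  obtains F' where "frame_along A (top_of_set (cball 0 1)) p F'"
    "\<And>z. z \<in> sphere 0 1 \<Longrightarrow> det (frame_ratio A (F z) (F' z)) = 1"
proof -
  let ?S = "sphere (0::complex^2) 1"
  have F0S: "frame_along A (top_of_set ?S) q F0"
    using frame_along_compose [OF F0, of "top_of_set ?S" "\<lambda>z. z"] p by (auto simp: frame_along_def)
  have base: "q z \<in> topspace (base A)" if "z \<in> ?S" for z
    using continuous_map_topspace [OF q] that by simp
  define G where "G z = frame_ratio A (F z) (F0 z)" for z
  have iso: "isometric_frame A (q z) (F z)" "isometric_frame A (q z) (F0 z)" if "z \<in> ?S" for z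
    using frame_alongD [OF F] frame_alongD [OF F0S] that by auto
  have G: "adjoint_mat (G z) ** G z = mat 1" if "z \<in> ?S" for z
    unfolding G_def by (rule frame_ratio_isometry [OF A base [OF that] iso [OF that]])
  have "continuous_on ?S G"
    using continuous_map_frame_ratio [OF A q F F0S] by (simp add: G_def)
  then have "continuous_on ?S (\<lambda>z. det (G z))"
    unfolding det_2 by (intro continuous_intros)
  moreover have "det (G z) \<noteq> 0" if "z \<in> ?S" for z
    using cmod_det_isometry [OF G [OF that]] by auto
  ultimately obtain l where l: "continuous_on ?S l" "\<And>z. z \<in> ?S \<Longrightarrow> det (G z) = exp (l z)"
    using continuous_logarithm_on_sphere [of "\<lambda>z. det (G z)"] by auto
  have l0: "l z = \<i> * of_real (Im (l z))" if "z \<in> ?S" for z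
    using cmod_det_isometry [OF G [OF that]] l(2) [OF that] by (simp add: complex_eq_iff)
  \<comment> \<open>Since the determinant has modulus 1, \<open>l\<close> is purely imaginary.
    Extending its real angle to the ball, instead of a complex function, keeps the correction
    \<open>D\<close> unitary off the sphere too.\<close>
  have "continuous_on ?S (\<lambda>z. Im (l z))"
    by (intro continuous_intros l)
  then obtain \<theta> :: "complex^2 \<Rightarrow> real" where \<theta>: "continuous_on UNIV \<theta>" "\<And>z. z \<in> ?S \<Longrightarrow> \<theta> z = Im (l z)"
    using Tietze_unbounded [of ?S "\<lambda>z. Im (l z)" UNIV] by auto
  define D where "D z = (\<chi> i j. if i = j then if i = 1 then exp (- (\<i> * of_real (\<theta> z))) else 1 else 0 :: complex^2^2)" for z
  have D_nth: "D z $1$1 = exp (- (\<i> * of_real (\<theta> z)))" "D z $1$2 = 0" "D z $2$1 = 0" "D z $2$2 = 1" for z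
    by (simp_all add: D_def)
  have D: "adjoint_mat (D z) ** D z = mat 1" for z
    by (simp add: mat2_eq_iff matrix_mul_2 mat_nth D_nth exp_cnj flip: exp_add)
  have "continuous_on (cball 0 1) D"
    using continuous_on_subset [OF \<theta>(1), of "cball 0 1"]
    unfolding continuous_on_matrix_iff by (auto simp: forall_2 D_nth intro!: continuous_intros)
  then have F': "frame_along A (top_of_set (cball 0 1)) p (\<lambda>z u. F0 z (D z *v u))"
    by (intro frame_along_change [OF F0]) (auto simp: D)
  have "det (frame_ratio A (F z) (\<lambda>u. F0 z (D z *v u))) = 1" if z: "z \<in> ?S" for z
  proof -
    have "frame_ratio A (F z) (\<lambda>u. F0 z (D z *v u)) = G z ** D z"
      using frame_ratio [OF A base [OF z] iso [OF z]]
      by (intro frame_ratioI [OF iso(1) [OF z]]) (simp add: G_def flip: matrix_vector_mul_assoc)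
    moreover have "det (D z) = exp (- l z)"
      by (simp add: det_2 D_nth \<theta>(2) [OF z] l0 [OF z, symmetric])
    ultimately show ?thesis
      by (simp add: det_mul l(2) [OF z] flip: exp_add)
  qed
  then show ?thesis using that F' by blast
qed

text \<open>The upper frame is the given trivialization; the lower one exists over the ball and is
  then made unimodular. Writing the given section as \<open>s'\<close> in the lower frame and as
  \<open>g\<close> in the upper one shows that \<open>g\<close> is the transition matrix applied to
  \<open>s'\<close> on the equator. A null homotopy would thus give \<open>g\<close> degree 0, not
  \<open>k\<close>.\<close>

lemma clutching_data_exists:
  fixes A :: "(nat \<Rightarrow> real, 'e) bundle_data"
  assumes A: "hermitian_bundle_rank2 A" and base: "base A = nsphere 4"
    and c2: "has_second_chern_number A k" "k \<noteq> 0"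
  shows "\<exists>F F' s. clutching_data A F F' s"
proof -
  let ?B = "cball (0::complex^2) 1" and ?S = "sphere (0::complex^2) 1"
  let ?u = "hemisphere_point 1" and ?l = "hemisphere_point (-1)"
  obtain \<phi> s g where \<phi>: "trivialization A upper_hemisphere \<phi>"
    and s: "nonvanishing_section_on A lower_hemisphere s"
    and sg: "\<And>x. x \<in> topspace (nsphere 3) \<Longrightarrow> s x = \<phi> (x, g x)"
    and deg: "Brouwer_degree2 3 (\<lambda>x. sphere_coords (g x)) = k"
    using c2(1) unfolding has_second_chern_number_def by blast
  have u: "continuous_map (top_of_set ?B) (subtopology (base A) upper_hemisphere) ?u"
    using continuous_map_hemisphere_point [of 1] hemisphere_point_upper
    by (auto simp: continuous_map_in_subtopology base)
  have l: "continuous_map (top_of_set ?B) (subtopology (base A) lower_hemisphere) ?l"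
    using continuous_map_hemisphere_point [of "-1"] hemisphere_point_lower
    by (auto simp: continuous_map_in_subtopology base)
  then have l': "continuous_map (top_of_set ?B) (base A) ?l"
    by (simp add: continuous_map_in_subtopology)
  define F where "F z u = \<phi> (?u z, u)" for z u
  have F: "frame_along A (top_of_set ?B) ?u F"
    using frame_along_compose [OF trivialization_frame_along [OF \<phi>] u] by (simp add: F_def [abs_def])
  obtain F0 where F0: "frame_along A (top_of_set ?B) ?l F0"
    using frame_along_cball [OF A l'] by auto
  have ul: "?l z = ?u z" if "z \<in> ?S" for z
    using hemisphere_point_equator(1) [OF that] .
  have uS: "continuous_map (top_of_set ?S) (base A) ?u" "frame_along A (top_of_set ?S) ?u F"
    using u continuous_map_from_subtopology_mono [of _ ?B _ ?u ?S]
      frame_along_compose [OF F, of "top_of_set ?S" "\<lambda>z. z"]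
    by (auto simp: continuous_map_in_subtopology)
  obtain F' where F': "frame_along A (top_of_set ?B) ?l F'"
    "\<And>z. z \<in> ?S \<Longrightarrow> det (frame_ratio A (F z) (F' z)) = 1"
    using unimodular_frame [OF A uS ul F0] by blast
  define s' where "s' z = frame_coords A (F' z) (s (?l z))" for z
  have sl: "s (?l z) \<in> fibre A (?l z)" "s (?l z) \<noteq> vzero A (?l z)" if "z \<in> ?B" for z
  proof -
    have "?l z \<in> topspace (base A) \<inter> lower_hemisphere"
      using continuous_map_topspace [OF l] that by simp
    then show "s (?l z) \<in> fibre A (?l z)" "s (?l z) \<noteq> vzero A (?l z)"
      using s continuous_map_topspace [of _ _ s "?l z"] by (auto simp: nonvanishing_section_on_def fibre_def)
  qed
  have isoF': "isometric_frame A (?l z) (F' z)" and lbase: "?l z \<in> topspace (base A)" if "z \<in> ?B" for z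
    using frame_alongD [OF F'(1)] continuous_map_topspace [OF l'] that by auto
  have s': "s (?l z) = F' z (s' z)" if "z \<in> ?B" for z
    using frame_coords_left_inverse [OF A lbase [OF that] isoF' [OF that] sl(1) [OF that]] by (simp add: s'_def)
  have s'0: "s' z \<noteq> 0" if "z \<in> ?B" for z
    using s' [OF that] sl(2) [OF that] isometric_frameD(2) [OF isoF' [OF that]] by auto
  have "continuous_map (top_of_set ?B) (total A) (\<lambda>z. s (?l z))"
    using continuous_map_compose [OF l] s by (auto simp: nonvanishing_section_on_def o_def)
  then have "continuous_map (top_of_set ?B) euclidean s'"
    unfolding s'_def frame_coords_def
    using continuous_map_frame_apply [OF F'(1) continuous_map_id [unfolded id_def], of "\<lambda>_. axis i 1" for i]
      isometric_frameD(1) [OF isoF'] sl(1)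
    by (intro continuous_map_vec_lambda continuous_map_vinner [OF A l']) (auto simp: fibre_def)
  then have s'_cont: "continuous_on ?B s'" by simp
  have "\<not> homotopic_with_canon (\<lambda>_. True) ?S (-{0}) (\<lambda>z. frame_ratio A (F z) (F' z) *v s' z) (\<lambda>_. a)" for a
  proof
    assume "homotopic_with_canon (\<lambda>_. True) ?S (-{0}) (\<lambda>z. frame_ratio A (F z) (F' z) *v s' z) (\<lambda>_. a)"
    then have "Brouwer_degree2 3 (\<lambda>x. sphere_coords (frame_ratio A (F (equatorial_projection x))
        (F' (equatorial_projection x)) *v s' (equatorial_projection x))) = 0"
      by (rule nullhomotopic_degree_0)
    moreover have "frame_ratio A (F z) (F' z) *v s' z = g x"
      if x: "x \<in> topspace (nsphere 3)" and z: "z = equatorial_projection x" for x z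
    proof -
      have zS: "z \<in> ?S" using equatorial_projection_in_sphere [OF x] z by simp
      then have zB: "z \<in> ?B" by simp
      have ux: "?u z = x"
        using x z hemisphere_point_equatorial_projection [of x 1] by (simp add: nsphere_3_eq)
      then have lx: "?l z = x" using ul [OF zS] by simp
      have isoF: "isometric_frame A x (F z)"
        using frame_alongD [OF F, of z] zB ux by simp
      have "F z (g x) = s x"
        using sg [OF x] by (simp add: F_def ux)
      also have "\<dots> = F' z (s' z)"
        using s' [OF zB] lx by simp
      also have "\<dots> = F z (frame_ratio A (F z) (F' z) *v s' z)"
        using frame_ratio [OF A _ isoF] isoF' [OF zB] lbase [OF zB] lx by simp
      finally show ?thesis
        using frame_coords_frame [OF isoF] by metis
    qed
    ultimately have "Brouwer_degree2 3 (\<lambda>x. sphere_coords (g x)) = 0"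
      using Brouwer_degree2_eq [of 3 "\<lambda>x. sphere_coords (g x)" "\<lambda>x. sphere_coords (frame_ratio A (F (equatorial_projection x))
        (F' (equatorial_projection x)) *v s' (equatorial_projection x))"] by simp
    then show False using deg c2(2) by simp
  qed
  then show ?thesis
    unfolding clutching_data_def using F F' s'_cont s'0 by blast
qed

text \<open>If no value were maximally entangled, the coefficient matrices over the two balls would
  satisfy the hypotheses of \<open>clutching_nullhomotopic\<close>: nonscalar by
  \<open>maximally_entangledI\<close>, related on the sphere by \<open>tensor_matrix_change\<close>.
  Its conclusion contradicts the last clause of \<open>clutching_data\<close>.\<close>

lemma maximally_entangled_point:
  assumes A: "hermitian_bundle_rank2 A" and base: "base A = nsphere 4"
    and FF': "clutching_data A F F' s"
    and \<psi>: "continuous_tensor_section A \<psi>" "nowhere_vanishing A \<psi>"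
  shows "\<exists>x\<in>topspace (nsphere 4). maximally_entangled A x (\<psi> x)"
proof (rule ccontr)
  assume "\<not> ?thesis"
  then have no: "\<not> maximally_entangled A x (\<psi> x)" if "x \<in> topspace (base A)" for x
    using that by (auto simp: base)
  let ?B = "cball (0::complex^2) 1" and ?S = "sphere (0::complex^2) 1"
  define M where "M \<sigma> E z = tensor_matrix A (hemisphere_point \<sigma> z) (E z) (\<psi> (hemisphere_point \<sigma> z))"
    for \<sigma> and E :: "complex^2 \<Rightarrow> complex^2 \<Rightarrow> 'a" and z
  have mem: "\<psi> x \<in> tensor_fibre A x" "\<psi> x \<noteq> (\<lambda>\<alpha> \<beta>. 0)" if "x \<in> topspace (base A)" for x
    using \<psi> that by (auto simp: continuous_tensor_section_def nowhere_vanishing_def)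
  have M: "continuous_on ?B (M \<sigma> E)" "\<And>z c. z \<in> ?B \<Longrightarrow> M \<sigma> E z ** adjoint_mat (M \<sigma> E z) \<noteq> mat c"
    if "\<bar>\<sigma>\<bar> = 1" "frame_along A (top_of_set ?B) (hemisphere_point \<sigma>) E" for \<sigma> E
  proof -
    have h: "continuous_map (top_of_set ?B) (base A) (hemisphere_point \<sigma>)"
      using continuous_map_hemisphere_point [OF that(1)] by (simp add: base)
    show "continuous_on ?B (M \<sigma> E)"
      using continuous_map_tensor_matrix [OF A h that(2) \<psi>(1)] by (simp add: M_def [abs_def])
    fix z c assume z: "z \<in> ?B"
    then have x: "hemisphere_point \<sigma> z \<in> topspace (base A)"
      using continuous_map_topspace [OF h] by simp
    show "M \<sigma> E z ** adjoint_mat (M \<sigma> E z) \<noteq> mat c"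
      using maximally_entangledI [OF A x _ mem [OF x]] frame_alongD [OF that(2)] z no [OF x]
      by (auto simp: M_def)
  qed
  have F: "frame_along A (top_of_set ?B) (hemisphere_point 1) F"
    and F': "frame_along A (top_of_set ?B) (hemisphere_point (-1)) F'"
    and s: "continuous_on ?B s" "\<And>z. z \<in> ?B \<Longrightarrow> s z \<noteq> 0"
    using FF' by (auto simp: clutching_data_def)
  define G where "G z = frame_ratio A (F z) (F' z)" for z
  let ?u = "hemisphere_point 1"
  have ul: "hemisphere_point (-1) z = ?u z" if "z \<in> ?S" for z
    using hemisphere_point_equator(1) [OF that] .
  have u: "continuous_map (top_of_set ?S) (base A) ?u"
    unfolding base by (rule continuous_map_from_subtopology_mono [OF continuous_map_hemisphere_point]) auto
  have FS: "frame_along A (top_of_set ?S) ?u F" "frame_along A (top_of_set ?S) ?u F'"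
    using frame_along_compose [OF F, of "top_of_set ?S" "\<lambda>z. z"]
      frame_along_compose [OF F', of "top_of_set ?S" "\<lambda>z. z"] ul
    by (auto simp: frame_along_def)
  have iso: "isometric_frame A (?u z) (F z)" "isometric_frame A (?u z) (F' z)" "?u z \<in> topspace (base A)"
    if "z \<in> ?S" for z
    using frame_alongD [OF FS(1)] frame_alongD [OF FS(2)] continuous_map_topspace [OF u] that by auto
  have "continuous_on ?S G"
    using continuous_map_frame_ratio [OF A u FS] by (simp add: G_def [abs_def])
  moreover have "adjoint_mat (G z) ** G z = mat 1" if "z \<in> ?S" for z
    using frame_ratio_isometry [OF A iso(3,1,2)] that by (simp add: G_def)
  moreover have "M 1 F z = G z ** M (-1) F' z ** transpose (G z)" if "z \<in> ?S" for z
    unfolding M_def ul [OF that] G_def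
    using iso [OF that] mem(1) [OF iso(3) [OF that]]
    by (intro tensor_matrix_change [OF A]) (auto intro: frame_ratio [OF A])
  ultimately have "\<exists>a. homotopic_with_canon (\<lambda>_. True) ?S (-{0}) (\<lambda>z. G z *v s z) (\<lambda>_. a)"
    using M [OF _ F] M [OF _ F'] s by (intro clutching_nullhomotopic [where M = "M 1 F" and M' = "M (-1) F'"]) auto
  then show False
    using FF' by (simp add: clutching_data_def G_def)
qed

text \<open>The ball frames are transported back to the hemispheres by
  \<open>equatorial_projection\<close>. Their transition has determinant 1 on the equator, so their
  wedges fit together.\<close>

lemma singlet_section:
  assumes A: "hermitian_bundle_rank2 A" and base: "base A = nsphere 4"
    and FF': "clutching_data A F F' s"
  shows "\<exists>\<psi>. continuous_tensor_section A \<psi> \<and> nowhere_vanishing A \<psi> \<and>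
          (\<forall>x\<in>topspace (nsphere 4). \<psi> x \<in> skew_fibre A x) \<and>
          (\<forall>x\<in>topspace (nsphere 4). singlet A x (\<psi> x))"
proof -
  let ?B = "cball (0::complex^2) 1" and ?P = equatorial_projection
  have pull: "frame_along A (subtopology (base A) R) (\<lambda>x. x) (\<lambda>x. E (?P x))"
    if E: "frame_along A (top_of_set ?B) (hemisphere_point \<sigma>) E"
      and R: "\<And>x. x \<in> R \<Longrightarrow> x \<in> topspace (nsphere 4) \<and> x 4 = \<sigma> * \<bar>x 4\<bar>" for R \<sigma> E
  proof -
    have "continuous_map (subtopology (base A) R) (top_of_set ?B) ?P"
      using continuous_map_from_subtopology [OF continuous_map_equatorial_projection] equatorial_projection_in_cball
      by (auto simp: base continuous_map_in_subtopology)
    from frame_along_compose [OF E this] show ?thesis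
      using R hemisphere_point_equatorial_projection by (auto simp: frame_along_def)
  qed
  have F: "frame_along A (subtopology (base A) upper_hemisphere) (\<lambda>x. x) (\<lambda>x. F (?P x))"
    using FF' by (intro pull) (auto simp: clutching_data_def upper_hemisphere_def)
  have F': "frame_along A (subtopology (base A) lower_hemisphere) (\<lambda>x. x) (\<lambda>x. F' (?P x))"
    using FF' by (intro pull) (auto simp: clutching_data_def lower_hemisphere_def)
  \<comment> \<open>\<open>E\<close> itself may jump across the equator, where it takes the value of
    the upper frame; only its wedge is continuous.\<close>
  define E where "E x = (if x \<in> upper_hemisphere then F (?P x) else F' (?P x))" for x
  have E: "isometric_frame A x (E x)" if "x \<in> topspace (nsphere 4)" for x
    using frame_alongD [OF F, of x] frame_alongD [OF F', of x] that
    by (auto simp: E_def base upper_hemisphere_def lower_hemisphere_def)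
  have closed: "closedin (base A) upper_hemisphere" "closedin (base A) lower_hemisphere"
    unfolding base upper_hemisphere_def lower_hemisphere_def
    using closedin_continuous_map_preimage [OF continuous_map_nsphere_projection [of 4 4], of "{0..}"]
      closedin_continuous_map_preimage [OF continuous_map_nsphere_projection [of 4 4], of "{..0}"]
    by auto
  have "continuous_tensor_section A (\<lambda>x. wedge A x (E x))"
    unfolding E_def
  proof (rule continuous_wedge_section [OF A closed _ F F'])
    show "topspace (base A) \<subseteq> upper_hemisphere \<union> lower_hemisphere"
      by (auto simp: base upper_hemisphere_def lower_hemisphere_def)
    show "det (frame_ratio A (F (?P x)) (F' (?P x))) = 1" if "x \<in> upper_hemisphere \<inter> lower_hemisphere" for x
    proof -
      have "x \<in> topspace (nsphere 3)"
        using that by (auto simp: nsphere_3_eq upper_hemisphere_def lower_hemisphere_def)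
      then show ?thesis
        using FF' equatorial_projection_in_sphere by (simp add: clutching_data_def)
    qed
  qed
  then show ?thesis
    using wedge_nonzero [OF A _ E] wedge_in_skew_fibre wedge_singlet [OF E] base
    by (intro exI [of _ "\<lambda>x. wedge A x (E x)"]) (auto simp: nowhere_vanishing_def)
qed

theorem mainTheorem2:
  fixes A :: "(nat \<Rightarrow> real, 'e) bundle_data"
  assumes "hermitian_bundle_rank2 A"
    and "base A = nsphere 4"
    and "has_second_chern_number A 1"
  shows
    "(\<not> (\<exists>\<psi>. continuous_tensor_section A \<psi> \<and> nowhere_vanishing A \<psi> \<and>
             (\<forall>x\<in>topspace (nsphere 4). simple_tensor A x (\<psi> x)))) \<and>
     (\<exists>\<psi>. continuous_tensor_section A \<psi> \<and> nowhere_vanishing A \<psi> \<and>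
          (\<forall>x\<in>topspace (nsphere 4). \<psi> x \<in> skew_fibre A x) \<and>
          (\<forall>x\<in>topspace (nsphere 4). singlet A x (\<psi> x))) \<and>
     (\<forall>\<psi>. continuous_tensor_section A \<psi> \<and> nowhere_vanishing A \<psi> \<and>
          (\<forall>x\<in>topspace (nsphere 4). \<psi> x \<in> sym_fibre A x) \<longrightarrow>
          (\<exists>x\<in>topspace (nsphere 4). maximally_entangled A x (\<psi> x)))"
proof -
  obtain F F' s where FF': "clutching_data A F F' s"
    using clutching_data_exists [OF assms] by auto
  have "\<not> simple_tensor A x t" if x: "x \<in> topspace (nsphere 4)" and "maximally_entangled A x t" for x t
  proof -
    obtain U \<phi> where "x \<in> U" "trivialization A U \<phi>"
      using assms(1) x unfolding hermitian_bundle_rank2_def assms(2) by blast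
    then show ?thesis
      using maximally_entangled_not_simple [OF assms(1)] trivialization_isometric_frame x that(2) assms(2)
      by metis
  qed
  then show ?thesis
    using maximally_entangled_point [OF assms(1,2) FF'] singlet_section [OF assms(1,2) FF'] by blast
qed

end
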